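(* Let $A$ be a connected, $\mathbb{N}$-graded, locally finite-dimensional algebra over a field $k$. Let $f\in A_d$ be a normal, regular homogeneous element of degree $d$ with normalizing automorphism $\sigma$. Let $\zeta=\{\zeta_n\mid n\in\mathbb{Z}\}$ be a (left) twisting system for $A$ such that for all $n\in\mathbb{Z}$, $\zeta_n\sigma\zeta_d=\sigma\zeta_{n+d}$ and $\zeta_n(f)=c^nf$, for some $c\in k^{\times}$ (independent of $n$). Then the categories $TMF_A(f)$ and $TMF_{A^{\zeta}}(f)$ are equivalent.
   Context: Conventions. $A=\bigoplus_{n\ge 0}A_n$ with $A_0=k$, $\dim_k A_i<\infty$. Modules are graded left modules and homomorphisms have degree $0$; $M(n)_i=M_{i+n}$. Regular means non-zero-divisor (on both sides); normal means $fA=Af$. The normalizing automorphism $\sigma$ of $f$ is the graded algebra automorphism with $af=f\sigma(a)$ for all $a$. $M^\sigma$ is $M$ as a graded abelian group with action $a\cdot m=\sigma(a)m$. Put $M^{tw}=M^{\sigma}(-d)$, where $d=\deg f$, and $\varphi^{tw}=\varphi$ on underlying groups. Left multiplication by $f$ is a degree $0$ homomorphism $\lambda_f^M:M^{tw}\to M$. A twisted left matrix factorization of $f$ over $A$ is a pair $(\varphi:F\to G,\ \tau:G^{tw}\to F)$ of degree $0$ maps of finitely generated graded free left $A$-modules with $\varphi\tau=\lambda_f^G$ and $\tau\varphi^{tw}=\lambda_f^F$. A morphism $(\varphi,\tau)\to(\varphi',\tau')$ is a pair of degree $0$ homomorphisms $\Psi_G:G\to G'$, $\Psi_F:F\to F'$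 with $\Psi_G\varphi=\varphi'\Psi_F$. $TMF_A(f)$ is the category of twisted left matrix factorizations of $f$ over $A$. A (left) twisting system for $A$ is a set $\zeta=\{\zeta_n\mid n\in\mathbb{Z}\}$ of graded $k$-linear automorphisms of $A$ (bijective degree-preserving $k$-linear maps) such that $\zeta_n(\zeta_m(x)y)=\zeta_{m+n}(x)\zeta_n(y)$ for all $n,m,\ell\in\mathbb{Z}$, $x\in A_\ell$, $y\in A_m$. The Zhang twist $A^\zeta$ is the graded $k$-algebra equal to $A$ as a graded vector space with multiplication $x\ast y=\zeta_m(x)y$ for $x\in A_\ell$, $y\in A_m$. Under the stated hypotheses $f$ is normal and regular in $A^\zeta$ with normalizing automorphism $\hat\sigma(a)=c^{-\deg a}\sigma\zeta_d(a)$ ($a$ homogeneous), and $TMF_{A^\zeta}(f)$ is defined using $\hat\sigma$. *)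

theory Defs
  imports "HOL-Algebra.Module" "HOL-Algebra.QuotRing"
begin

section \<open>Categories and equivalences\<close>

text \<open>Hom-sets are indexed by their endpoints and need not be disjoint. Composition
  \<open>composite C X Y Z g f\<close> is that of \<open>f : X \<rightarrow> Y\<close> followed by \<open>g : Y \<rightarrow> Z\<close>.\<close>

record ('o, 'f) category =
  obj :: "'o set"
  hom_set :: "'o \<Rightarrow> 'o \<Rightarrow> 'f set"
  composite :: "'o \<Rightarrow> 'o \<Rightarrow> 'o \<Rightarrow> 'f \<Rightarrow> 'f \<Rightarrow> 'f"
  ident :: "'o \<Rightarrow> 'f"

locale is_category =
  fixes C :: "('o, 'f) category"
  assumes ident_hom: "X \<in> obj C \<Longrightarrow> ident C X \<in> hom_set C X X"
    and comp_hom: "\<lbrakk>X \<in> obj C; Y \<in> obj C; Z \<in> obj C;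
        f \<in> hom_set C X Y; g \<in> hom_set C Y Z\<rbrakk>
      \<Longrightarrow> composite C X Y Z g f \<in> hom_set C X Z"
    and ident_right: "\<lbrakk>X \<in> obj C; Y \<in> obj C; f \<in> hom_set C X Y\<rbrakk>
      \<Longrightarrow> composite C X X Y f (ident C X) = f"
    and ident_left: "\<lbrakk>X \<in> obj C; Y \<in> obj C; f \<in> hom_set C X Y\<rbrakk>
      \<Longrightarrow> composite C X Y Y (ident C Y) f = f"
    and comp_assoc: "\<lbrakk>W \<in> obj C; X \<in> obj C; Y \<in> obj C; Z \<in> obj C;
        f \<in> hom_set C W X; g \<in> hom_set C X Y; h \<in> hom_set C Y Z\<rbrakk>
      \<Longrightarrow> composite C W Y Z h (composite C W X Y g f)
        = composite C W X Z (composite C X Y Z h g) f"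

text \<open>A functor is given by its object map \<open>P\<close> and its arrow map \<open>p X Y : Hom(X, Y) \<rightarrow> Hom(P X, P Y)\<close>.\<close>

definition is_functor ::
  "('o, 'f) category \<Rightarrow> ('p, 'g) category \<Rightarrow> ('o \<Rightarrow> 'p) \<Rightarrow> ('o \<Rightarrow> 'o \<Rightarrow> 'f \<Rightarrow> 'g) \<Rightarrow> bool"
where
  "is_functor C D P p \<longleftrightarrow>
     (\<forall>X\<in>obj C. P X \<in> obj D) \<and>
     (\<forall>X\<in>obj C. \<forall>Y\<in>obj C. \<forall>f\<in>hom_set C X Y. p X Y f \<in> hom_set D (P X) (P Y)) \<and>
     (\<forall>X\<in>obj C. p X X (ident C X) = ident D (P X)) \<and>
     (\<forall>X\<in>obj C. \<forall>Y\<in>obj C. \<forall>Z\<in>obj C. \<forall>f\<in>hom_set C X Y. \<forall>g\<in>hom_set C Y Z.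
        p X Z (composite C X Y Z g f)
          = composite D (P X) (P Y) (P Z) (p Y Z g) (p X Y f))"

definition is_isomorphism :: "('o, 'f) category \<Rightarrow> 'o \<Rightarrow> 'o \<Rightarrow> 'f \<Rightarrow> bool" where
  "is_isomorphism C X Y f \<longleftrightarrow> f \<in> hom_set C X Y \<and>
     (\<exists>g\<in>hom_set C Y X.
        composite C X Y X g f = ident C X \<and> composite C Y X Y f g = ident C Y)"

definition is_natural_isomorphism ::
  "('o, 'f) category \<Rightarrow> ('p, 'g) category \<Rightarrow>
   ('o \<Rightarrow> 'p) \<Rightarrow> ('o \<Rightarrow> 'o \<Rightarrow> 'f \<Rightarrow> 'g) \<Rightarrow> ('o \<Rightarrow> 'p) \<Rightarrow> ('o \<Rightarrow> 'o \<Rightarrow> 'f \<Rightarrow> 'g) \<Rightarrow>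
   ('o \<Rightarrow> 'g) \<Rightarrow> bool"
where
  "is_natural_isomorphism C D P p Q q \<eta> \<longleftrightarrow>
     (\<forall>X\<in>obj C. is_isomorphism D (P X) (Q X) (\<eta> X)) \<and>
     (\<forall>X\<in>obj C. \<forall>Y\<in>obj C. \<forall>f\<in>hom_set C X Y.
        composite D (P X) (P Y) (Q Y) (\<eta> Y) (p X Y f)
          = composite D (P X) (Q X) (Q Y) (q X Y f) (\<eta> X))"

definition equivalent_categories :: "('o, 'f) category \<Rightarrow> ('p, 'g) category \<Rightarrow> bool" where
  "equivalent_categories C D \<longleftrightarrow>
     is_category C \<and> is_category D \<and>
     (\<exists>P p Q q \<eta> \<epsilon>.
        is_functor C D P p \<and> is_functor D C Q q \<and>
        is_natural_isomorphism C C (\<lambda>X. X) (\<lambda>X Y f. f)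
          (\<lambda>X. Q (P X)) (\<lambda>X Y f. q (P X) (P Y) (p X Y f)) \<eta> \<and>
        is_natural_isomorphism D D (\<lambda>X. P (Q X)) (\<lambda>X Y f. p (Q X) (Q Y) (q X Y f))
          (\<lambda>X. X) (\<lambda>X Y f. f) \<epsilon>)"


section \<open>Graded algebras and graded modules\<close>

text \<open>Both algebras and modules use the following records, with \<open>grade M i\<close> for the homogeneous
  component of degree \<open>i\<close>. As everywhere with \<^typ>\<open>('a, 'm) module\<close>, the fields
  \<open>mult\<close> and \<open>one\<close> carry no information when the record is used as a module. Algebras
  are graded by the integers with vanishing components in negative degrees.\<close>

record ('a, 'm) graded_module = "('a, 'm) module" +
  grade :: "int \<Rightarrow> 'm set"

definition homogeneous_decomposition ::
  "('a, 'm) graded_module \<Rightarrow> 'm \<Rightarrow> (int \<Rightarrow> 'm) \<Rightarrow> bool"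
where
  "homogeneous_decomposition M x h \<longleftrightarrow>
     (\<forall>i. h i \<in> grade M i) \<and> finite {i. h i \<noteq> \<zero>\<^bsub>M\<^esub>} \<and>
     x = (\<Oplus>\<^bsub>M\<^esub>i\<in>{i. h i \<noteq> \<zero>\<^bsub>M\<^esub>}. h i)"

locale graded_group = abelian_group M for M :: "('a, 'm) graded_module" (structure) +
  assumes grade_subgroup: "additive_subgroup (grade M i) M"
    and grade_decomposition: "x \<in> carrier M \<Longrightarrow> \<exists>!h. homogeneous_decomposition M x h"

definition hcomp :: "('a, 'm) graded_module \<Rightarrow> 'm \<Rightarrow> int \<Rightarrow> 'm" where
  "hcomp M x = (THE h. homogeneous_decomposition M x h)"

definition hsupport :: "('a, 'm) graded_module \<Rightarrow> 'm \<Rightarrow> int set" where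
  "hsupport M x = {i. hcomp M x i \<noteq> \<zero>\<^bsub>M\<^esub>}"

text \<open>\<open>B\<close> is a finite basis of the \<open>R\<close>-submodule \<open>V\<close> of \<open>M\<close>.\<close>

definition finite_basis ::
  "('a, 'r) ring_scheme \<Rightarrow> ('a, 'm, 's) module_scheme \<Rightarrow> 'm set \<Rightarrow> 'm set \<Rightarrow> bool"
where
  "finite_basis R M V B \<longleftrightarrow> finite B \<and> B \<subseteq> V \<and>
     (\<forall>v\<in>V. \<exists>!u. u \<in> B \<rightarrow>\<^sub>E carrier R \<and> v = (\<Oplus>\<^bsub>M\<^esub>b\<in>B. u b \<odot>\<^bsub>M\<^esub> b))"

text \<open>Only the \<^locale>\<open>module\<close> structure of \<open>A\<close> over the field can be taken from the library:
  \<^locale>\<open>algebra\<close> is about commutative algebras.\<close>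

locale connected_graded_algebra = K: field K + module K A + A: ring A + graded_group A
  for K :: "('k, 'r) ring_scheme" (structure) and A :: "('k, 'a) graded_module" (structure) +
  assumes smult_mult_left: "\<lbrakk>\<alpha> \<in> carrier K; x \<in> carrier A; y \<in> carrier A\<rbrakk>
      \<Longrightarrow> (\<alpha> \<odot>\<^bsub>A\<^esub> x) \<otimes>\<^bsub>A\<^esub> y = \<alpha> \<odot>\<^bsub>A\<^esub> (x \<otimes>\<^bsub>A\<^esub> y)"
    and smult_mult_right: "\<lbrakk>\<alpha> \<in> carrier K; x \<in> carrier A; y \<in> carrier A\<rbrakk>
      \<Longrightarrow> x \<otimes>\<^bsub>A\<^esub> (\<alpha> \<odot>\<^bsub>A\<^esub> y) = \<alpha> \<odot>\<^bsub>A\<^esub> (x \<otimes>\<^bsub>A\<^esub> y)"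
    and grade_smult: "\<lbrakk>\<alpha> \<in> carrier K; x \<in> grade A i\<rbrakk> \<Longrightarrow> \<alpha> \<odot>\<^bsub>A\<^esub> x \<in> grade A i"
    and grade_mult: "\<lbrakk>x \<in> grade A i; y \<in> grade A j\<rbrakk> \<Longrightarrow> x \<otimes>\<^bsub>A\<^esub> y \<in> grade A (i + j)"
    and grade_negative: "i < 0 \<Longrightarrow> grade A i = {\<zero>\<^bsub>A\<^esub>}"
    and connected: "\<one>\<^bsub>A\<^esub> \<noteq> \<zero>\<^bsub>A\<^esub>" "grade A 0 = (\<lambda>\<alpha>. \<alpha> \<odot>\<^bsub>A\<^esub> \<one>\<^bsub>A\<^esub>) ` carrier K"
    and locally_finite: "\<exists>B. finite_basis K A (grade A i) B"

locale graded_left_module = A: ring A + graded_group M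
  for A :: "('k, 'a) graded_module" (structure) and M :: "('a, 'm) graded_module" (structure) +
  assumes act_closed: "\<lbrakk>a \<in> carrier A; x \<in> carrier M\<rbrakk> \<Longrightarrow> a \<odot>\<^bsub>M\<^esub> x \<in> carrier M"
    and act_add_left: "\<lbrakk>a \<in> carrier A; b \<in> carrier A; x \<in> carrier M\<rbrakk>
      \<Longrightarrow> (a \<oplus>\<^bsub>A\<^esub> b) \<odot>\<^bsub>M\<^esub> x = a \<odot>\<^bsub>M\<^esub> x \<oplus>\<^bsub>M\<^esub> b \<odot>\<^bsub>M\<^esub> x"
    and act_add_right: "\<lbrakk>a \<in> carrier A; x \<in> carrier M; y \<in> carrier M\<rbrakk>
      \<Longrightarrow> a \<odot>\<^bsub>M\<^esub> (x \<oplus>\<^bsub>M\<^esub> y) = a \<odot>\<^bsub>M\<^esub> x \<oplus>\<^bsub>M\<^esub> a \<odot>\<^bsub>M\<^esub> y"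
    and act_mult: "\<lbrakk>a \<in> carrier A; b \<in> carrier A; x \<in> carrier M\<rbrakk>
      \<Longrightarrow> (a \<otimes>\<^bsub>A\<^esub> b) \<odot>\<^bsub>M\<^esub> x = a \<odot>\<^bsub>M\<^esub> (b \<odot>\<^bsub>M\<^esub> x)"
    and act_one: "x \<in> carrier M \<Longrightarrow> \<one>\<^bsub>A\<^esub> \<odot>\<^bsub>M\<^esub> x = x"
    and act_grade: "\<lbrakk>a \<in> grade A i; x \<in> grade M j\<rbrakk> \<Longrightarrow> a \<odot>\<^bsub>M\<^esub> x \<in> grade M (i + j)"

text \<open>Graded free means having a basis of homogeneous elements.\<close>

definition fg_graded_free :: "('k, 'a) graded_module \<Rightarrow> ('a, 'm) graded_module \<Rightarrow> bool" where
  "fg_graded_free A M \<longleftrightarrow> graded_left_module A M \<and>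
     (\<exists>B. finite_basis A M (carrier M) B \<and> (\<forall>b\<in>B. \<exists>i. b \<in> grade M i))"

text \<open>Homomorphisms are extensional, so that they are equal as soon as they agree on the carrier.\<close>

definition graded_hom ::
  "('k, 'a) graded_module \<Rightarrow> ('a, 'm) graded_module \<Rightarrow> ('a, 'n) graded_module \<Rightarrow> ('m \<Rightarrow> 'n) set"
where
  "graded_hom A M N = {\<phi> \<in> carrier M \<rightarrow>\<^sub>E carrier N.
     (\<forall>x\<in>carrier M. \<forall>y\<in>carrier M. \<phi> (x \<oplus>\<^bsub>M\<^esub> y) = \<phi> x \<oplus>\<^bsub>N\<^esub> \<phi> y) \<and>
     (\<forall>a\<in>carrier A. \<forall>x\<in>carrier M. \<phi> (a \<odot>\<^bsub>M\<^esub> x) = a \<odot>\<^bsub>N\<^esub> \<phi> x) \<and>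
     (\<forall>i. \<phi> ` grade M i \<subseteq> grade N i)}"


section \<open>Normal regular elements and twisting systems\<close>

definition normal_element :: "('k, 'a) graded_module \<Rightarrow> 'a \<Rightarrow> bool" where
  "normal_element A f \<longleftrightarrow> f \<in> carrier A \<and> f <#\<^bsub>A\<^esub> carrier A = carrier A #>\<^bsub>A\<^esub> f"

definition regular_element :: "('k, 'a) graded_module \<Rightarrow> 'a \<Rightarrow> bool" where
  "regular_element A f \<longleftrightarrow> f \<in> carrier A \<and>
     (\<forall>a\<in>carrier A. f \<otimes>\<^bsub>A\<^esub> a = \<zero>\<^bsub>A\<^esub> \<longrightarrow> a = \<zero>\<^bsub>A\<^esub>) \<and>
     (\<forall>a\<in>carrier A. a \<otimes>\<^bsub>A\<^esub> f = \<zero>\<^bsub>A\<^esub> \<longrightarrow> a = \<zero>\<^bsub>A\<^esub>)"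

definition graded_linear_automorphism ::
  "('k, 'r) ring_scheme \<Rightarrow> ('k, 'a) graded_module \<Rightarrow> ('a \<Rightarrow> 'a) \<Rightarrow> bool"
where
  "graded_linear_automorphism K A \<theta> \<longleftrightarrow> bij_betw \<theta> (carrier A) (carrier A) \<and>
     (\<forall>x\<in>carrier A. \<forall>y\<in>carrier A. \<theta> (x \<oplus>\<^bsub>A\<^esub> y) = \<theta> x \<oplus>\<^bsub>A\<^esub> \<theta> y) \<and>
     (\<forall>\<alpha>\<in>carrier K. \<forall>x\<in>carrier A. \<theta> (\<alpha> \<odot>\<^bsub>A\<^esub> x) = \<alpha> \<odot>\<^bsub>A\<^esub> \<theta> x) \<and>
     (\<forall>i. \<theta> ` grade A i \<subseteq> grade A i)"

definition graded_algebra_automorphism ::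
  "('k, 'r) ring_scheme \<Rightarrow> ('k, 'a) graded_module \<Rightarrow> ('a \<Rightarrow> 'a) \<Rightarrow> bool"
where
  "graded_algebra_automorphism K A \<theta> \<longleftrightarrow>
     graded_linear_automorphism K A \<theta> \<and> \<theta> \<in> ring_iso A A"

definition normalizing_automorphism ::
  "('k, 'r) ring_scheme \<Rightarrow> ('k, 'a) graded_module \<Rightarrow> 'a \<Rightarrow> ('a \<Rightarrow> 'a) \<Rightarrow> bool"
where
  "normalizing_automorphism K A f \<sigma> \<longleftrightarrow> graded_algebra_automorphism K A \<sigma> \<and>
     (\<forall>a\<in>carrier A. a \<otimes>\<^bsub>A\<^esub> f = f \<otimes>\<^bsub>A\<^esub> \<sigma> a)"

definition twisting_system ::
  "('k, 'r) ring_scheme \<Rightarrow> ('k, 'a) graded_module \<Rightarrow> (int \<Rightarrow> 'a \<Rightarrow> 'a) \<Rightarrow> bool"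
where
  "twisting_system K A \<zeta> \<longleftrightarrow> (\<forall>n. graded_linear_automorphism K A (\<zeta> n)) \<and>
     (\<forall>n m l. \<forall>x\<in>grade A l. \<forall>y\<in>grade A m.
        \<zeta> n (\<zeta> m x \<otimes>\<^bsub>A\<^esub> y) = \<zeta> (m + n) x \<otimes>\<^bsub>A\<^esub> \<zeta> n y)"

text \<open>The multiplication \<open>x * y = \<zeta> m x \<cdot> y\<close> for \<open>y\<close> of degree \<open>m\<close> is extended additively
  to arbitrary \<open>y\<close> (see \<open>zhang_twist_mult_homogeneous\<close> below). A twisting system
  is not required to satisfy \<open>\<zeta> 0 = id\<close>; the identity element of the twist
  is therefore the preimage of the old one under \<open>\<zeta> 0\<close>.\<close>

definition zhang_twist ::
  "('k, 'a) graded_module \<Rightarrow> (int \<Rightarrow> 'a \<Rightarrow> 'a) \<Rightarrow> ('k, 'a) graded_module"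
where
  "zhang_twist A \<zeta> = A\<lparr>
     mult := (\<lambda>x y. \<Oplus>\<^bsub>A\<^esub>m\<in>hsupport A y. \<zeta> m x \<otimes>\<^bsub>A\<^esub> hcomp A y m),
     one := inv_into (carrier A) (\<zeta> 0) \<one>\<^bsub>A\<^esub>\<rparr>"

text \<open>The additive extension of \<open>a \<mapsto> c\<^sup>-\<^sup>i \<sigma> (\<zeta> d a)\<close> for \<open>a\<close> of degree \<open>i\<close>.\<close>

definition twisted_automorphism ::
  "('k, 'r) ring_scheme \<Rightarrow> ('k, 'a) graded_module \<Rightarrow> nat \<Rightarrow> ('a \<Rightarrow> 'a) \<Rightarrow>
   (int \<Rightarrow> 'a \<Rightarrow> 'a) \<Rightarrow> 'k \<Rightarrow> 'a \<Rightarrow> 'a"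
where
  "twisted_automorphism K A d \<sigma> \<zeta> c a =
     (\<Oplus>\<^bsub>A\<^esub>i\<in>hsupport A a. (c [^]\<^bsub>K\<^esub> (- i)) \<odot>\<^bsub>A\<^esub> \<sigma> (\<zeta> (int d) (hcomp A a i)))"


section \<open>Twisted matrix factorizations\<close>

text \<open>\<open>M\<^sup>t\<^sup>w = M\<^sup>\<sigma>(-d)\<close>. A map \<open>\<phi>\<close> and its twist \<open>\<phi>\<^sup>t\<^sup>w\<close> are the same function.\<close>

definition tw :: "nat \<Rightarrow> ('a \<Rightarrow> 'a) \<Rightarrow> ('a, 'm) graded_module \<Rightarrow> ('a, 'm) graded_module" where
  "tw d \<sigma> M = M\<lparr>smult := (\<lambda>a x. \<sigma> a \<odot>\<^bsub>M\<^esub> x), grade := (\<lambda>i. grade M (i - int d))\<rparr>"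

definition left_mult :: "'a \<Rightarrow> ('a, 'm) graded_module \<Rightarrow> 'm \<Rightarrow> 'm" where
  "left_mult f M = (\<lambda>x\<in>carrier M. f \<odot>\<^bsub>M\<^esub> x)"

record ('a, 'm) factorization =
  src :: "('a, 'm) graded_module"
  tgt :: "('a, 'm) graded_module"
  phi :: "'m \<Rightarrow> 'm"
  tau :: "'m \<Rightarrow> 'm"

definition twisted_factorization ::
  "('k, 'a) graded_module \<Rightarrow> 'a \<Rightarrow> nat \<Rightarrow> ('a \<Rightarrow> 'a) \<Rightarrow> ('a, 'm) factorization \<Rightarrow> bool"
where
  "twisted_factorization A f d \<sigma> X \<longleftrightarrow>
     fg_graded_free A (src X) \<and> fg_graded_free A (tgt X) \<and>
     phi X \<in> graded_hom A (src X) (tgt X) \<and>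
     tau X \<in> graded_hom A (tw d \<sigma> (tgt X)) (src X) \<and>
     compose (carrier (tgt X)) (phi X) (tau X) = left_mult f (tgt X) \<and>
     compose (carrier (src X)) (tau X) (phi X) = left_mult f (src X)"

text \<open>All modules underlying the objects of one category live on subsets of a type \<open>'m\<close>, which
  plays the role of the universe; statements about \<open>TMF\<close> are meant for arbitrary \<open>'m\<close>. Every
  finitely generated module over \<open>A\<close> is isomorphic to one on the type \<^typ>\<open>(nat \<Rightarrow> 'a) set\<close>.

  Morphisms are the pairs \<open>(\<Psi>\<^sub>G, \<Psi>\<^sub>F)\<close>.\<close>

definition factorization_hom ::
  "('k, 'a) graded_module \<Rightarrow> ('a, 'm) factorization \<Rightarrow> ('a, 'm) factorization \<Rightarrow>
   (('m \<Rightarrow> 'm) \<times> ('m \<Rightarrow> 'm)) set"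
where
  "factorization_hom A X Y = {(\<Psi>G, \<Psi>F).
     \<Psi>G \<in> graded_hom A (tgt X) (tgt Y) \<and> \<Psi>F \<in> graded_hom A (src X) (src Y) \<and>
     compose (carrier (src X)) \<Psi>G (phi X) = compose (carrier (src X)) (phi Y) \<Psi>F}"

definition TMF ::
  "('k, 'a) graded_module \<Rightarrow> 'a \<Rightarrow> nat \<Rightarrow> ('a \<Rightarrow> 'a) \<Rightarrow>
   (('a, 'm) factorization, ('m \<Rightarrow> 'm) \<times> ('m \<Rightarrow> 'm)) category"
where
  "TMF A f d \<sigma> = \<lparr>
     obj = {X. twisted_factorization A f d \<sigma> X},
     hom_set = factorization_hom A,
     composite = (\<lambda>X Y Z (\<Psi>G', \<Psi>F') (\<Psi>G, \<Psi>F).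
       (compose (carrier (tgt X)) \<Psi>G' \<Psi>G, compose (carrier (src X)) \<Psi>F' \<Psi>F)),
     ident = (\<lambda>X. (\<lambda>x\<in>carrier (tgt X). x, \<lambda>x\<in>carrier (src X). x))\<rparr>"


section \<open>The twist on homogeneous elements\<close>

lemma (in graded_group) hcomp_homogeneous:
  assumes "x \<in> grade M m"
  shows "hcomp M x = (\<lambda>i. if i = m then x else \<zero>)"
proof -
  have sub: "grade M i \<subseteq> carrier M" "\<zero> \<in> grade M i" for i
    using additive_subgroup.a_subset[OF grade_subgroup]
      additive_subgroup.zero_closed[OF grade_subgroup] by auto
  let ?h = "\<lambda>i. if i = m then x else \<zero>"
  have x: "x \<in> carrier M"
    using assms sub by blast
  have "homogeneous_decomposition M x ?h"
  proof (cases "x = \<zero>")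
    case True
    then show ?thesis
      using sub by (simp add: homogeneous_decomposition_def)
  next
    case False
    then have "{i. ?h i \<noteq> \<zero>} = {m}"
      by auto
    then show ?thesis
      using assms sub x by (simp add: homogeneous_decomposition_def)
  qed
  then show ?thesis
    unfolding hcomp_def using grade_decomposition[OF x] by (blast intro: the1_equality)
qed

lemma (in graded_group) hsupport_homogeneous:
  "x \<in> grade M m \<Longrightarrow> hsupport M x = (if x = \<zero> then {} else {m})"
  by (auto simp: hsupport_def hcomp_homogeneous)

lemma graded_linear_automorphism_closed:
  "\<lbrakk>graded_linear_automorphism K A \<theta>; x \<in> carrier A\<rbrakk> \<Longrightarrow> \<theta> x \<in> carrier A"
  by (auto simp: graded_linear_automorphism_def dest: bij_betwE)

lemma (in connected_graded_algebra) zhang_twist_mult_homogeneous: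
  assumes \<zeta>: "twisting_system K A \<zeta>" and x: "x \<in> carrier A" and y: "y \<in> grade A m"
  shows "x \<otimes>\<^bsub>zhang_twist A \<zeta>\<^esub> y = \<zeta> m x \<otimes>\<^bsub>A\<^esub> y"
proof -
  have "y \<in> carrier A"
    using y additive_subgroup.a_subset[OF grade_subgroup] by blast
  moreover have "\<zeta> m x \<in> carrier A"
    using \<zeta> x by (auto simp: twisting_system_def intro: graded_linear_automorphism_closed)
  ultimately show ?thesis
    by (simp add: zhang_twist_def hsupport_homogeneous[OF y] hcomp_homogeneous[OF y])
qed

lemma (in connected_graded_algebra) twisted_automorphism_homogeneous:
  assumes \<zeta>: "twisting_system K A \<zeta>" and \<sigma>: "graded_algebra_automorphism K A \<sigma>"
    and c: "c \<in> carrier K - {\<zero>\<^bsub>K\<^esub>}" and a: "a \<in> grade A i"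
  shows "twisted_automorphism K A d \<sigma> \<zeta> c a = (c [^]\<^bsub>K\<^esub> (- i)) \<odot>\<^bsub>A\<^esub> \<sigma> (\<zeta> (int d) a)"
proof -
  have aA: "a \<in> carrier A"
    using a additive_subgroup.a_subset[OF grade_subgroup] by blast
  have \<zeta>A: "\<zeta> (int d) x \<in> carrier A" if "x \<in> carrier A" for x
    using \<zeta> that by (auto simp: twisting_system_def intro: graded_linear_automorphism_closed)
  have \<sigma>A: "\<sigma> x \<in> carrier A" if "x \<in> carrier A" for x
    using \<sigma> that
    by (auto simp: graded_algebra_automorphism_def intro: graded_linear_automorphism_closed)
  have "c \<in> Units K"
    using c K.field_Units by simp
  have "c [^]\<^bsub>K\<^esub> n \<in> Units K" for n :: nat
  proof (induction n)
    case 0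
    then show ?case by simp
  next
    case (Suc n)
    then show ?case
      using K.Units_m_closed[OF Suc \<open>c \<in> Units K\<close>] by simp
  qed
  then have pow: "c [^]\<^bsub>K\<^esub> (- i) \<in> carrier K"
    unfolding int_pow_def2 by (metis K.Units_closed K.Units_inv_closed)
  have zero: "\<sigma> (\<zeta> (int d) \<zero>\<^bsub>A\<^esub>) = \<zero>\<^bsub>A\<^esub>"
  proof -
    have *: "\<sigma> (\<zeta> (int d) (\<zero>\<^bsub>K\<^esub> \<odot>\<^bsub>A\<^esub> \<zero>\<^bsub>A\<^esub>)) = \<zero>\<^bsub>K\<^esub> \<odot>\<^bsub>A\<^esub> \<sigma> (\<zeta> (int d) \<zero>\<^bsub>A\<^esub>)"
      using \<zeta> \<sigma> \<zeta>A[of "\<zero>\<^bsub>A\<^esub>"]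
      by (simp add: twisting_system_def graded_algebra_automorphism_def
          graded_linear_automorphism_def del: smult_l_null smult_r_null)
    then show ?thesis
      using \<zeta>A \<sigma>A by simp
  qed
  show ?thesis
    using aA \<zeta>A \<sigma>A pow zero
    by (simp add: twisted_automorphism_def hsupport_homogeneous[OF a] hcomp_homogeneous[OF a])
qed

end

theory Submission
  imports Defs
begin

text \<open>Twisting a graded \<open>A\<close>-module \<open>M\<close> to the \<open>A\<^sup>\<zeta>\<close>-module with the action
  \<open>a * x = \<zeta> n a \<cdot> x\<close> for \<open>x\<close> of degree \<open>n\<close> changes neither the graded homomorphisms nor the homogeneous
  bases, and it is undone by the same construction for the inverses of the \<open>\<zeta> n\<close>. A factorization
  \<open>(\<phi>, \<tau>)\<close> is sent to \<open>(\<phi>, \<tau>')\<close> with \<open>\<tau>' x = c\<^sup>n \<tau> x\<close> for \<open>x\<close> of degree \<open>n\<close>: the scalar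
  makes \<open>\<tau>'\<close> linear for the new normalizing automorphism, and it also accounts for
  \<open>f * x = c\<^sup>n f x\<close>. Morphisms do not involve \<open>\<tau>\<close>, so they stay the same.\<close>

section \<open>Graded groups\<close>

text \<open>In general the inverses of the \<open>\<zeta> n\<close> twist not \<open>A\<close> but
  \<open>A^\<zeta>\<close>. To serve both directions, the argument is built on the rule
  \<open>\<zeta> n (x * y) = \<zeta> (n + m) x \<cdot> \<zeta> n y\<close> for \<open>y\<close> of
  degree \<open>m\<close>, which has the new product on one side and the old one on the other.
  Linearity of the new \<tau> is where the hypotheses meet. For \<open>a\<close> of degree
  \<open>l\<close> and \<open>x\<close> of degree \<open>n\<close>, passing from \<open>x\<close> to
  \<open>\<sigma>' a * x\<close> raises the power of \<open>c\<close> by \<open>l\<close>, which the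
  factor \<open>c^(-l)\<close> in \<open>\<sigma>'\<close> undoes. As the image of \<open>x\<close>
  has degree \<open>n + d\<close>, \<open>a\<close> acts on it through
  \<open>\<zeta> (n + d)\<close>, and this is the index in
  \<open>\<zeta> n \<sigma> \<zeta> d = \<sigma> \<zeta> (n + d)\<close>. Twisting there and back
  restores the carriers and the action on them, but not necessarily the records, whose values
  outside the carriers are unspecified. Hence the composite functors are related to the identity by
  natural isomorphisms made of identity maps, not by equality.\<close>

context graded_group
begin

lemma grade_closed: "x \<in> grade M i \<Longrightarrow> x \<in> carrier M"
  using additive_subgroup.a_subset[OF grade_subgroup] by blast

lemma grade_zero: "\<zero> \<in> grade M i"
  by (rule additive_subgroup.zero_closed[OF grade_subgroup])

lemma grade_add: "\<lbrakk>x \<in> grade M i; y \<in> grade M i\<rbrakk> \<Longrightarrow> x \<oplus> y \<in> grade M i"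
  by (rule additive_subgroup.a_closed[OF grade_subgroup])

lemma homogeneous_decomposition_hcomp:
  "x \<in> carrier M \<Longrightarrow> homogeneous_decomposition M x (hcomp M x)"
  unfolding hcomp_def by (rule theI'[OF grade_decomposition])

lemma hcomp_grade: "x \<in> carrier M \<Longrightarrow> hcomp M x i \<in> grade M i"
  using homogeneous_decomposition_hcomp by (auto simp: homogeneous_decomposition_def)

lemma hcomp_closed: "x \<in> carrier M \<Longrightarrow> hcomp M x i \<in> carrier M"
  by (rule grade_closed[OF hcomp_grade])

lemma finite_hsupport: "x \<in> carrier M \<Longrightarrow> finite (hsupport M x)"
  using homogeneous_decomposition_hcomp by (auto simp: homogeneous_decomposition_def hsupport_def)

lemma finsum_hcomp: "x \<in> carrier M \<Longrightarrow> (\<Oplus>i\<in>hsupport M x. hcomp M x i) = x"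
  using homogeneous_decomposition_hcomp by (auto simp: homogeneous_decomposition_def hsupport_def)

lemma hcomp_eqI:
  assumes h: "\<And>i. h i \<in> grade M i" and S: "finite S" "\<And>i. i \<notin> S \<Longrightarrow> h i = \<zero>"
    and x: "x = (\<Oplus>i\<in>S. h i)"
  shows "hcomp M x = h"
proof -
  have hc: "h i \<in> carrier M" for i
    by (rule grade_closed[OF h])
  have sub: "{i. h i \<noteq> \<zero>} \<subseteq> S"
    using S(2) by blast
  have "(\<Oplus>i\<in>S. h i) = (\<Oplus>i\<in>{i. h i \<noteq> \<zero>}. h i)"
    by (rule add.finprod_mono_neutral_cong_right[OF S(1) sub]) (use hc in auto)
  then have "homogeneous_decomposition M x h"
    using h x finite_subset[OF sub S(1)] by (auto simp: homogeneous_decomposition_def)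
  moreover have "x \<in> carrier M"
    using x hc by simp
  ultimately show ?thesis
    unfolding hcomp_def using grade_decomposition by (blast intro: the1_equality)
qed

lemma finsum_hsupport_mono:
  assumes "x \<in> carrier M" "finite S" "hsupport M x \<subseteq> S" "abelian_group N"
    and "\<And>i. g i (hcomp M x i) \<in> carrier N" "\<And>i. g i \<zero> = \<zero>\<^bsub>N\<^esub>"
  shows "(\<Oplus>\<^bsub>N\<^esub>i\<in>S. g i (hcomp M x i)) = (\<Oplus>\<^bsub>N\<^esub>i\<in>hsupport M x. g i (hcomp M x i))"
proof -
  interpret N: abelian_group N by fact
  show ?thesis
    by (rule N.add.finprod_mono_neutral_cong_right) (use assms in \<open>auto simp: hsupport_def\<close>)
qed

lemma hcomp_add:
  assumes x: "x \<in> carrier M" and y: "y \<in> carrier M"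
  shows "hcomp M (x \<oplus> y) = (\<lambda>i. hcomp M x i \<oplus> hcomp M y i)"
proof (rule hcomp_eqI)
  let ?S = "hsupport M x \<union> hsupport M y"
  show "finite ?S"
    using finite_hsupport x y by simp
  show "hcomp M x i \<oplus> hcomp M y i \<in> grade M i" for i
    using hcomp_grade x y by (simp add: grade_add)
  show "hcomp M x i \<oplus> hcomp M y i = \<zero>" if "i \<notin> ?S" for i
    using that by (simp add: hsupport_def)
  have *: "(\<Oplus>i\<in>?S. hcomp M z i) = z" if "z = x \<or> z = y" for z
    using finsum_hsupport_mono[where g = "\<lambda>i z. z" and N = M, of z ?S] that x y finite_hsupport
    by (auto simp: finsum_hcomp hcomp_closed abelian_group_axioms)
  show "x \<oplus> y = (\<Oplus>i\<in>?S. hcomp M x i \<oplus> hcomp M y i)"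
    using x y by (simp add: * hcomp_closed add.finprod_multf)
qed

text \<open>An element is the finite sum of its components, and the empty sum is zero, which is
  homogeneous of every degree. Formulas that depend on the degree are carried to all elements by
  this rule.\<close>

lemma homogeneous_induct [consumes 1, case_names homogeneous add]:
  assumes x: "x \<in> carrier M"
    and hom: "\<And>i x. x \<in> grade M i \<Longrightarrow> P x"
    and add: "\<And>x y. \<lbrakk>x \<in> carrier M; y \<in> carrier M; P x; P y\<rbrakk> \<Longrightarrow> P (x \<oplus> y)"
  shows "P x"
proof -
  have "P (\<Oplus>i\<in>S. hcomp M x i)" if "finite S" for S
    using that
  proof (induction S)
    case empty
    show ?case using hom[OF grade_zero] by simp
  next
    case (insert i S)
    then show ?case
      using x add hom[OF hcomp_grade[OF x]] by (simp add: hcomp_closed)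
  qed
  then show ?thesis
    using finsum_hcomp[OF x] finite_hsupport[OF x] by metis
qed

end

section \<open>Graded groups that differ only in multiplication or action\<close>

lemma homogeneous_decomposition_cong:
  fixes M N :: "('a, 'm) graded_module"
  assumes "carrier N = carrier M" "add N = add M" "zero N = zero M" "grade N = grade M"
  shows "homogeneous_decomposition N = homogeneous_decomposition M"
proof -
  have "add_monoid N = add_monoid M"
    using assms by simp
  then have "finsum N = (finsum M :: (int \<Rightarrow> _) \<Rightarrow> _)"
    by (simp add: finsum_def)
  then show ?thesis
    using assms by (intro ext) (simp add: homogeneous_decomposition_def)
qed

lemma abelian_group_cong:
  fixes M N :: "('a, 's) ring_scheme"
  assumes "abelian_group M" "carrier N = carrier M" "add N = add M" "zero N = zero M"
  shows "abelian_group N"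
proof -
  have "add_monoid N = add_monoid M"
    using assms by simp
  then show ?thesis
    using assms by (simp add: abelian_group_def abelian_group_axioms_def abelian_monoid_def)
qed

lemma graded_group_cong:
  fixes M N :: "('a, 'm) graded_module"
  assumes "graded_group M"
    and "carrier N = carrier M" "add N = add M" "zero N = zero M" "grade N = grade M"
  shows "graded_group N"
proof -
  interpret M: graded_group M by fact
  have "additive_subgroup (grade N i) N" for i
    using M.grade_subgroup[of i] assms by (simp add: additive_subgroup_def)
  then show ?thesis
    unfolding graded_group_def graded_group_axioms_def
    using abelian_group_cong[OF M.abelian_group_axioms] M.grade_decomposition
      homogeneous_decomposition_cong[of N M] assms
    by auto
qed

text \<open>The Zhang product, the twisted action, the new \<tau> and the new normalizing
  automorphism are all prescribed degree by degree; as instances of one construction they need a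
  single proof of additivity. The index is passed to \<open>g\<close> because the formula changes
  with the degree.\<close>

definition additive_extension ::
  "('a, 'm) graded_module \<Rightarrow> ('n, 's) ring_scheme \<Rightarrow> (int \<Rightarrow> 'm \<Rightarrow> 'n) \<Rightarrow> 'm \<Rightarrow> 'n"
where
  "additive_extension M N g x = (\<Oplus>\<^bsub>N\<^esub>i\<in>hsupport M x. g i (hcomp M x i))"

locale homogeneous_additive = M: graded_group M + N: abelian_group N
  for M :: "('a, 'm) graded_module" and N :: "('n, 's) ring_scheme" and g :: "int \<Rightarrow> 'm \<Rightarrow> 'n" +
  assumes map_closed: "x \<in> grade M i \<Longrightarrow> g i x \<in> carrier N"
    and map_add: "\<lbrakk>x \<in> grade M i; y \<in> grade M i\<rbrakk> \<Longrightarrow> g i (x \<oplus>\<^bsub>M\<^esub> y) = g i x \<oplus>\<^bsub>N\<^esub> g i y"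
begin

lemma map_zero: "g i \<zero>\<^bsub>M\<^esub> = \<zero>\<^bsub>N\<^esub>"
proof -
  have "g i \<zero>\<^bsub>M\<^esub> \<oplus>\<^bsub>N\<^esub> g i \<zero>\<^bsub>M\<^esub> = g i \<zero>\<^bsub>M\<^esub>"
    using map_add[OF M.grade_zero M.grade_zero, of i] by simp
  then show ?thesis
    using map_closed[OF M.grade_zero, of i] by (metis N.add.r_cancel_one')
qed

lemma map_hcomp_closed: "x \<in> carrier M \<Longrightarrow> g i (hcomp M x i) \<in> carrier N"
  by (rule map_closed[OF M.hcomp_grade])

lemma extension_closed: "x \<in> carrier M \<Longrightarrow> additive_extension M N g x \<in> carrier N"
  unfolding additive_extension_def by (rule N.finsum_closed) (auto intro: map_hcomp_closed)

lemma extension_homogeneous: "x \<in> grade M i \<Longrightarrow> additive_extension M N g x = g i x"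
  using map_closed[of x i] map_zero
  by (simp add: additive_extension_def M.hsupport_homogeneous M.hcomp_homogeneous)

text \<open>Cancellation can make the support of a sum smaller than the union of the supports. All
  three sums are therefore taken over the union, where \<open>map_zero\<close> kills the extra
  terms.\<close>

lemma extension_add:
  assumes x: "x \<in> carrier M" and y: "y \<in> carrier M"
  shows "additive_extension M N g (x \<oplus>\<^bsub>M\<^esub> y)
    = additive_extension M N g x \<oplus>\<^bsub>N\<^esub> additive_extension M N g y"
proof -
  let ?S = "hsupport M x \<union> hsupport M y"
  have fin: "finite ?S"
    using x y M.finite_hsupport by simp
  have sub: "hsupport M (x \<oplus>\<^bsub>M\<^esub> y) \<subseteq> ?S"
    using x y by (auto simp: hsupport_def M.hcomp_add)
  have ext: "additive_extension M N g z = (\<Oplus>\<^bsub>N\<^esub>i\<in>?S. g i (hcomp M z i))"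
    if "z \<in> carrier M" "hsupport M z \<subseteq> ?S" for z
    unfolding additive_extension_def
    by (rule M.finsum_hsupport_mono[symmetric])
      (use that fin in \<open>auto simp: map_zero map_hcomp_closed N.abelian_group_axioms\<close>)
  have "additive_extension M N g (x \<oplus>\<^bsub>M\<^esub> y)
      = (\<Oplus>\<^bsub>N\<^esub>i\<in>?S. g i (hcomp M x i) \<oplus>\<^bsub>N\<^esub> g i (hcomp M y i))"
    using x y sub by (simp add: ext M.hcomp_add map_add M.hcomp_grade)
  also have "\<dots> = (\<Oplus>\<^bsub>N\<^esub>i\<in>?S. g i (hcomp M x i)) \<oplus>\<^bsub>N\<^esub> (\<Oplus>\<^bsub>N\<^esub>i\<in>?S. g i (hcomp M y i))"
    using x y by (intro N.finsum_addf) (auto intro: map_hcomp_closed)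
  finally show ?thesis
    using x y by (simp add: ext)
qed

end

section \<open>Categories of twisted factorizations\<close>

lemma graded_homD:
  assumes "\<phi> \<in> graded_hom A M N"
  shows "x \<in> carrier M \<Longrightarrow> \<phi> x \<in> carrier N"
    and "\<lbrakk>x \<in> carrier M; y \<in> carrier M\<rbrakk> \<Longrightarrow> \<phi> (x \<oplus>\<^bsub>M\<^esub> y) = \<phi> x \<oplus>\<^bsub>N\<^esub> \<phi> y"
    and "\<lbrakk>a \<in> carrier A; x \<in> carrier M\<rbrakk> \<Longrightarrow> \<phi> (a \<odot>\<^bsub>M\<^esub> x) = a \<odot>\<^bsub>N\<^esub> \<phi> x"
    and "x \<in> grade M i \<Longrightarrow> \<phi> x \<in> grade N i"
    and "\<phi> \<in> extensional (carrier M)"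
  using assms unfolding graded_hom_def PiE_def by blast+

lemma graded_homI:
  assumes "\<phi> \<in> extensional (carrier M)"
    and "\<And>x. x \<in> carrier M \<Longrightarrow> \<phi> x \<in> carrier N"
    and "\<And>x y. \<lbrakk>x \<in> carrier M; y \<in> carrier M\<rbrakk> \<Longrightarrow> \<phi> (x \<oplus>\<^bsub>M\<^esub> y) = \<phi> x \<oplus>\<^bsub>N\<^esub> \<phi> y"
    and "\<And>a x. \<lbrakk>a \<in> carrier A; x \<in> carrier M\<rbrakk> \<Longrightarrow> \<phi> (a \<odot>\<^bsub>M\<^esub> x) = a \<odot>\<^bsub>N\<^esub> \<phi> x"
    and "\<And>i x. x \<in> grade M i \<Longrightarrow> \<phi> x \<in> grade N i"
  shows "\<phi> \<in> graded_hom A M N"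
  using assms by (auto simp: graded_hom_def PiE_def)

lemma graded_hom_compose:
  assumes "graded_left_module A M" "\<phi> \<in> graded_hom A M N" "\<psi> \<in> graded_hom A N P"
  shows "compose (carrier M) \<psi> \<phi> \<in> graded_hom A M P"
proof -
  interpret M: graded_left_module A M by fact
  show ?thesis
    by (rule graded_homI)
      (simp_all add: compose_eq M.act_closed M.grade_closed
        graded_homD[OF assms(2)] graded_homD[OF assms(3)])
qed

text \<open>Meant for modules that need not be equal as records, since their actions may differ
  outside the carriers. A module and its double twist are related in this way.\<close>

lemma graded_hom_ident:
  assumes "graded_left_module A M"
    and "carrier N = carrier M" "add N = add M" "grade N = grade M"
    and "\<And>a x. \<lbrakk>a \<in> carrier A; x \<in> carrier M\<rbrakk> \<Longrightarrow> a \<odot>\<^bsub>N\<^esub> x = a \<odot>\<^bsub>M\<^esub> x"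
  shows "(\<lambda>x\<in>carrier M. x) \<in> graded_hom A M N" "(\<lambda>x\<in>carrier M. x) \<in> graded_hom A N M"
proof -
  interpret M: graded_left_module A M by fact
  show "(\<lambda>x\<in>carrier M. x) \<in> graded_hom A M N" "(\<lambda>x\<in>carrier M. x) \<in> graded_hom A N M"
    using assms by (auto intro!: graded_homI simp: M.act_closed dest: M.grade_closed)
qed

lemma compose_ident_right:
  "\<phi> \<in> extensional S \<Longrightarrow> compose S \<phi> (\<lambda>x\<in>S. x) = \<phi>"
  by (auto simp: compose_def extensional_def)

lemma compose_ident_left:
  "\<lbrakk>\<phi> \<in> extensional S; \<And>x. x \<in> S \<Longrightarrow> \<phi> x \<in> T\<rbrakk> \<Longrightarrow> compose S (\<lambda>x\<in>T. x) \<phi> = \<phi>"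
  by (auto simp: compose_def extensional_def)

lemma compose_assoc_extensional:
  "(\<And>x. x \<in> S \<Longrightarrow> f x \<in> T) \<Longrightarrow> compose S h (compose S g f) = compose S (compose T h g) f"
  by (auto simp: compose_def)

lemma twisted_factorizationD:
  assumes "twisted_factorization A f d \<sigma> X"
  shows "graded_left_module A (src X)" "graded_left_module A (tgt X)"
    "phi X \<in> graded_hom A (src X) (tgt X)"
    "tau X \<in> graded_hom A (tw d \<sigma> (tgt X)) (src X)"
    "x \<in> carrier (tgt X) \<Longrightarrow> phi X (tau X x) = f \<odot>\<^bsub>tgt X\<^esub> x"
    "x' \<in> carrier (src X) \<Longrightarrow> tau X (phi X x') = f \<odot>\<^bsub>src X\<^esub> x'"
proof -
  have c: "compose (carrier (tgt X)) (phi X) (tau X) = left_mult f (tgt X)"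
    "compose (carrier (src X)) (tau X) (phi X) = left_mult f (src X)"
    using assms by (auto simp: twisted_factorization_def)
  show "x \<in> carrier (tgt X) \<Longrightarrow> phi X (tau X x) = f \<odot>\<^bsub>tgt X\<^esub> x"
    using fun_cong[OF c(1), of x] by (simp add: compose_eq left_mult_def)
  show "x' \<in> carrier (src X) \<Longrightarrow> tau X (phi X x') = f \<odot>\<^bsub>src X\<^esub> x'"
    using fun_cong[OF c(2), of x'] by (simp add: compose_eq left_mult_def)
qed (use assms in \<open>auto simp: twisted_factorization_def fg_graded_free_def\<close>)

lemma factorization_homD:
  assumes "(\<Psi>G, \<Psi>F) \<in> factorization_hom A X Y"
  shows "\<Psi>G \<in> graded_hom A (tgt X) (tgt Y)" "\<Psi>F \<in> graded_hom A (src X) (src Y)"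
    "x \<in> carrier (src X) \<Longrightarrow> \<Psi>G (phi X x) = phi Y (\<Psi>F x)"
proof -
  have "compose (carrier (src X)) \<Psi>G (phi X) = compose (carrier (src X)) (phi Y) \<Psi>F"
    using assms by (simp add: factorization_hom_def)
  from fun_cong[OF this, of x]
  show "x \<in> carrier (src X) \<Longrightarrow> \<Psi>G (phi X x) = phi Y (\<Psi>F x)"
    by (simp add: compose_eq)
qed (use assms in \<open>auto simp: factorization_hom_def\<close>)

lemma factorization_homI:
  assumes "\<Psi>G \<in> graded_hom A (tgt X) (tgt Y)" "\<Psi>F \<in> graded_hom A (src X) (src Y)"
    "\<And>x. x \<in> carrier (src X) \<Longrightarrow> \<Psi>G (phi X x) = phi Y (\<Psi>F x)"
  shows "(\<Psi>G, \<Psi>F) \<in> factorization_hom A X Y"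
  using assms by (auto simp: factorization_hom_def compose_def)

text \<open>What the laws require comes from the objects, which carry graded modules over
  \<open>A\<close>. The parameters stay arbitrary, so that one proof covers both categories of the
  theorem.\<close>

lemma is_category_TMF: "is_category (TMF A f d \<sigma>)"
proof
  fix X assume "X \<in> obj (TMF A f d \<sigma>)"
  then have X: "twisted_factorization A f d \<sigma> X"
    by (simp add: TMF_def)
  show "ident (TMF A f d \<sigma>) X \<in> hom_set (TMF A f d \<sigma>) X X"
    using twisted_factorizationD(1,2,3)[OF X]
    by (auto simp: TMF_def intro!: factorization_homI graded_hom_ident dest: graded_homD)
next
  fix X Y Z \<psi> \<chi>
  assume "X \<in> obj (TMF A f d \<sigma>)" "Y \<in> obj (TMF A f d \<sigma>)" "Z \<in> obj (TMF A f d \<sigma>)"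
    and "\<psi> \<in> hom_set (TMF A f d \<sigma>) X Y" "\<chi> \<in> hom_set (TMF A f d \<sigma>) Y Z"
  then obtain \<psi>G \<psi>F \<chi>G \<chi>F
    where X: "twisted_factorization A f d \<sigma> X" and eq: "\<psi> = (\<psi>G, \<psi>F)" "\<chi> = (\<chi>G, \<chi>F)"
      and "(\<psi>G, \<psi>F) \<in> factorization_hom A X Y" "(\<chi>G, \<chi>F) \<in> factorization_hom A Y Z"
    by (cases \<psi>, cases \<chi>) (auto simp: TMF_def)
  note \<psi> = factorization_homD[OF this(4)] and \<chi> = factorization_homD[OF this(5)]
  show "composite (TMF A f d \<sigma>) X Y Z \<chi> \<psi> \<in> hom_set (TMF A f d \<sigma>) X Z"
    using \<psi> \<chi> graded_homD(1)[OF \<psi>(2)] graded_homD(1)[OF twisted_factorizationD(3)[OF X]]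
    by (auto simp: TMF_def eq compose_eq
        intro!: factorization_homI graded_hom_compose twisted_factorizationD(1,2)[OF X])
next
  fix X Y \<psi>
  assume "\<psi> \<in> hom_set (TMF A f d \<sigma>) X Y"
  then obtain \<psi>G \<psi>F where eq: "\<psi> = (\<psi>G, \<psi>F)" and "(\<psi>G, \<psi>F) \<in> factorization_hom A X Y"
    by (cases \<psi>) (auto simp: TMF_def)
  note \<psi> = factorization_homD[OF this(2)]
  show "composite (TMF A f d \<sigma>) X X Y \<psi> (ident (TMF A f d \<sigma>) X) = \<psi>"
    using \<psi>(1,2) by (simp add: TMF_def eq compose_ident_right graded_homD)
  show "composite (TMF A f d \<sigma>) X Y Y (ident (TMF A f d \<sigma>) Y) \<psi> = \<psi>"
    using \<psi>(1,2) by (simp add: TMF_def eq compose_ident_left graded_homD)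
next
  fix W X Y Z \<psi> \<chi> \<omega>
  assume "\<psi> \<in> hom_set (TMF A f d \<sigma>) W X"
  then obtain \<psi>G \<psi>F where eq: "\<psi> = (\<psi>G, \<psi>F)" and "(\<psi>G, \<psi>F) \<in> factorization_hom A W X"
    by (cases \<psi>) (auto simp: TMF_def)
  note \<psi> = factorization_homD[OF this(2)]
  show "composite (TMF A f d \<sigma>) W Y Z \<omega> (composite (TMF A f d \<sigma>) W X Y \<chi> \<psi>)
      = composite (TMF A f d \<sigma>) W X Z (composite (TMF A f d \<sigma>) X Y Z \<omega> \<chi>) \<psi>"
    using graded_homD(1)[OF \<psi>(1)] graded_homD(1)[OF \<psi>(2)]
    by (auto simp: TMF_def eq split_beta intro!: compose_assoc_extensional)
qed

section \<open>Twisting modules\<close>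

text \<open>Zhang's twist of a graded module. Only \<open>x\<close> is split into components,
  because each \<open>\<theta> i\<close> is already a map on the whole algebra.\<close>

definition twist_module :: "(int \<Rightarrow> 'a \<Rightarrow> 'a) \<Rightarrow> ('a, 'm) graded_module \<Rightarrow> ('a, 'm) graded_module" where
  "twist_module \<theta> M = M\<lparr>smult := (\<lambda>a. additive_extension M M (\<lambda>i x. \<theta> i a \<odot>\<^bsub>M\<^esub> x))\<rparr>"

lemma twist_module_simps [simp]:
  "carrier (twist_module \<theta> M) = carrier M" "add (twist_module \<theta> M) = add M"
  "zero (twist_module \<theta> M) = zero M" "grade (twist_module \<theta> M) = grade M"
  by (simp_all add: twist_module_def)

text \<open>The conditions say that \<open>\<theta>\<close> identifies \<open>B\<close> with the Zhang twist of \<open>A\<close>. They are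
  symmetric under exchanging \<open>A\<close> with \<open>B\<close> and \<open>\<theta>\<close> with \<open>\<theta>'\<close>.\<close>

locale ring_twist = A: ring A + A: graded_group A + B: ring B
  for A B :: "('k, 'a) graded_module" and \<theta> \<theta>' :: "int \<Rightarrow> 'a \<Rightarrow> 'a" +
  assumes same: "carrier B = carrier A" "add B = add A" "zero B = zero A" "grade B = grade A"
    and \<theta>_inv_left: "x \<in> carrier A \<Longrightarrow> \<theta>' n (\<theta> n x) = x"
    and \<theta>_inv_right: "x \<in> carrier A \<Longrightarrow> \<theta> n (\<theta>' n x) = x"
    and \<theta>_closed: "x \<in> carrier A \<Longrightarrow> \<theta> n x \<in> carrier A"
    and \<theta>_inv_closed: "x \<in> carrier A \<Longrightarrow> \<theta>' n x \<in> carrier A"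
    and \<theta>_grade: "x \<in> grade A i \<Longrightarrow> \<theta> n x \<in> grade A i"
    and \<theta>_inv_grade: "x \<in> grade A i \<Longrightarrow> \<theta>' n x \<in> grade A i"
    and \<theta>_add: "\<lbrakk>x \<in> carrier A; y \<in> carrier A\<rbrakk> \<Longrightarrow> \<theta> n (x \<oplus>\<^bsub>A\<^esub> y) = \<theta> n x \<oplus>\<^bsub>A\<^esub> \<theta> n y"
    and \<theta>_mult: "\<lbrakk>x \<in> carrier A; y \<in> grade A m\<rbrakk>
      \<Longrightarrow> \<theta> n (x \<otimes>\<^bsub>B\<^esub> y) = \<theta> (n + m) x \<otimes>\<^bsub>A\<^esub> \<theta> n y"
    and \<theta>_one: "\<theta> n \<one>\<^bsub>B\<^esub> = \<one>\<^bsub>A\<^esub>"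
begin

lemma \<theta>_eqD: "\<lbrakk>\<theta> n x = \<theta> n y; x \<in> carrier A; y \<in> carrier A\<rbrakk> \<Longrightarrow> x = y"
  using \<theta>_inv_left by metis

lemma one_closed: "\<one>\<^bsub>B\<^esub> \<in> carrier A"
  using B.one_closed same by simp

lemma mult_closed: "\<lbrakk>x \<in> carrier A; y \<in> carrier A\<rbrakk> \<Longrightarrow> x \<otimes>\<^bsub>B\<^esub> y \<in> carrier A"
  using B.m_closed same by simp

text \<open>Each \<open>\<theta> n\<close> is injective, so a law for \<open>\<theta>'\<close> can
  be tested after applying \<open>\<theta> n\<close>. The multiplicative law becomes
  \<open>\<theta>_mult\<close> for \<open>\<theta>' (n + m) x\<close> and
  \<open>\<theta>' n y\<close>, the latter still of degree \<open>m\<close>.\<close>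

lemma inverse_twist: "ring_twist B A \<theta>' \<theta>"
proof -
  have "graded_group B"
    by (rule graded_group_cong[OF A.graded_group_axioms]) (simp_all add: same)
  moreover have "\<theta>' n (x \<oplus>\<^bsub>A\<^esub> y) = \<theta>' n x \<oplus>\<^bsub>A\<^esub> \<theta>' n y"
    if "x \<in> carrier A" "y \<in> carrier A" for n x y
    by (rule \<theta>_eqD[of n]) (simp_all add: that \<theta>_add \<theta>_inv_closed \<theta>_inv_right)
  moreover have "\<theta>' n (x \<otimes>\<^bsub>A\<^esub> y) = \<theta>' (n + m) x \<otimes>\<^bsub>B\<^esub> \<theta>' n y"
    if "x \<in> carrier A" "y \<in> grade A m" for n m x y
    by (rule \<theta>_eqD[of n])
      (use that in \<open>simp_all add: \<theta>_mult[OF \<theta>_inv_closed \<theta>_inv_grade] \<theta>_inv_closed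
        \<theta>_inv_right A.grade_closed mult_closed\<close>)
  moreover have "\<theta>' n \<one>\<^bsub>A\<^esub> = \<one>\<^bsub>B\<^esub>" for n
    using \<theta>_inv_left[OF one_closed, of n] \<theta>_one by simp
  ultimately show ?thesis
    using A.ring_axioms B.ring_axioms
    by (simp add: ring_twist_def ring_twist_axioms_def same \<theta>_inv_left \<theta>_inv_right
        \<theta>_closed \<theta>_inv_closed \<theta>_grade \<theta>_inv_grade)
qed

end

locale twisted_module = ring_twist A B \<theta> \<theta>' + M: graded_left_module A M
  for A B :: "('k, 'a) graded_module" and \<theta> \<theta>' and M :: "('a, 'm) graded_module"
begin

lemma action_additive:
  "a \<in> carrier A \<Longrightarrow> homogeneous_additive M M (\<lambda>i x. \<theta> i a \<odot>\<^bsub>M\<^esub> x)"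
  using M.grade_closed
  by unfold_locales (auto simp: \<theta>_closed M.act_closed M.act_add_right)

lemma twist_act:
  "\<lbrakk>a \<in> carrier A; x \<in> grade M i\<rbrakk> \<Longrightarrow> a \<odot>\<^bsub>twist_module \<theta> M\<^esub> x = \<theta> i a \<odot>\<^bsub>M\<^esub> x"
  by (simp add: twist_module_def homogeneous_additive.extension_homogeneous[OF action_additive])

lemma twist_act_closed:
  "\<lbrakk>a \<in> carrier A; x \<in> carrier M\<rbrakk> \<Longrightarrow> a \<odot>\<^bsub>twist_module \<theta> M\<^esub> x \<in> carrier M"
  by (simp add: twist_module_def homogeneous_additive.extension_closed[OF action_additive])

lemma twist_act_add:
  "\<lbrakk>a \<in> carrier A; x \<in> carrier M; y \<in> carrier M\<rbrakk> \<Longrightarrow>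
   a \<odot>\<^bsub>twist_module \<theta> M\<^esub> (x \<oplus>\<^bsub>M\<^esub> y) = a \<odot>\<^bsub>twist_module \<theta> M\<^esub> x \<oplus>\<^bsub>M\<^esub> a \<odot>\<^bsub>twist_module \<theta> M\<^esub> y"
  by (simp add: twist_module_def homogeneous_additive.extension_add[OF action_additive])

lemma twist_add_act:
  assumes ab: "a \<in> carrier A" "b \<in> carrier A" and x: "x \<in> carrier M"
  shows "(a \<oplus>\<^bsub>A\<^esub> b) \<odot>\<^bsub>twist_module \<theta> M\<^esub> x
    = a \<odot>\<^bsub>twist_module \<theta> M\<^esub> x \<oplus>\<^bsub>M\<^esub> b \<odot>\<^bsub>twist_module \<theta> M\<^esub> x"
  using x
proof (induction x rule: M.homogeneous_induct)
  case (homogeneous i x)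
  then show ?case
    using ab by (simp add: twist_act \<theta>_add \<theta>_closed M.act_add_left M.grade_closed)
next
  case (add x y)
  then show ?case
    using ab by (simp add: twist_act_add twist_act_closed M.a_ac)
qed

text \<open>For \<open>b\<close> of degree \<open>m\<close> and \<open>x\<close> of degree
  \<open>n\<close>, \<open>\<theta>_mult\<close> turns the left side into the action of
  \<open>\<theta> n b\<close> followed by that of \<open>\<theta> (n + m) a\<close>. The right side
  has the same index, as \<open>\<theta> n b\<close> moves \<open>x\<close> to degree
  \<open>m + n\<close>.\<close>

lemma twist_mult_act:
  assumes a: "a \<in> carrier A" and b: "b \<in> carrier A" and x: "x \<in> carrier M"
  shows "(a \<otimes>\<^bsub>B\<^esub> b) \<odot>\<^bsub>twist_module \<theta> M\<^esub> x
    = a \<odot>\<^bsub>twist_module \<theta> M\<^esub> (b \<odot>\<^bsub>twist_module \<theta> M\<^esub> x)"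
  using x
proof (induction x rule: M.homogeneous_induct)
  case (homogeneous n x)
  note x = this
  from b show ?case
  proof (induction b rule: A.homogeneous_induct)
    case (homogeneous m b)
    then have "\<theta> n b \<odot>\<^bsub>M\<^esub> x \<in> grade M (m + n)"
      using x by (simp add: M.act_grade \<theta>_grade)
    then show ?case
      using a x homogeneous
      by (simp add: twist_act mult_closed \<theta>_mult \<theta>_closed M.act_mult A.grade_closed M.grade_closed
          add.commute)
  next
    case (add b b')
    have "a \<otimes>\<^bsub>B\<^esub> (b \<oplus>\<^bsub>A\<^esub> b') = a \<otimes>\<^bsub>B\<^esub> b \<oplus>\<^bsub>A\<^esub> a \<otimes>\<^bsub>B\<^esub> b'"
      using B.r_distr[of b b' a] add a by (simp add: same)
    then show ?case
      using a x add
      by (simp add: mult_closed twist_add_act twist_act_add twist_act_closed M.grade_closed)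
  qed
next
  case (add x y)
  then show ?case
    using a b by (simp add: mult_closed twist_act_add twist_act_closed)
qed

lemma twist_one_act: "x \<in> carrier M \<Longrightarrow> \<one>\<^bsub>B\<^esub> \<odot>\<^bsub>twist_module \<theta> M\<^esub> x = x"
proof (induction x rule: M.homogeneous_induct)
  case (homogeneous i x)
  then show ?case
    by (simp add: one_closed twist_act \<theta>_one M.act_one M.grade_closed)
next
  case (add x y)
  then show ?case
    by (simp add: one_closed twist_act_add)
qed

lemma graded_left_module_twist: "graded_left_module B (twist_module \<theta> M)"
proof -
  have "graded_group (twist_module \<theta> M)"
    by (rule graded_group_cong[OF M.graded_group_axioms]) simp_all
  moreover have "a \<odot>\<^bsub>twist_module \<theta> M\<^esub> x \<in> grade M (i + j)"
    if "a \<in> grade A i" "x \<in> grade M j" for a x i j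
    using that by (simp add: twist_act \<theta>_grade M.act_grade A.grade_closed)
  ultimately show ?thesis
    using B.ring_axioms
    by (simp add: graded_left_module_def graded_left_module_axioms_def same twist_act_closed
        twist_act_add twist_add_act twist_mult_act twist_one_act)
qed

text \<open>Since \<open>b\<close> is homogeneous, the twisted action of \<open>a\<close> on it is
  the old action of \<open>\<theta> (deg b) a\<close>. A combination in the twist is thus an old one
  whose coefficient at each \<open>b\<close> is changed by the bijection
  \<open>\<theta> (deg b)\<close>.\<close>

lemma finite_basis_twist:
  assumes basis: "finite_basis A M (carrier M) S" and hom: "\<And>b. b \<in> S \<Longrightarrow> b \<in> grade M (deg b)"
  shows "finite_basis B (twist_module \<theta> M) (carrier M) S"
proof -
  have S: "finite S" "S \<subseteq> carrier M"
    and ex1: "\<And>v. v \<in> carrier M \<Longrightarrow>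
      \<exists>!u. u \<in> S \<rightarrow>\<^sub>E carrier A \<and> v = (\<Oplus>\<^bsub>M\<^esub>b\<in>S. u b \<odot>\<^bsub>M\<^esub> b)"
    using basis by (auto simp: finite_basis_def)
  have fs: "finsum (twist_module \<theta> M) = (finsum M :: ('m \<Rightarrow> 'm) \<Rightarrow> _)"
    by (simp add: finsum_def)
  let ?U = "\<lambda>u. \<lambda>b\<in>S. \<theta> (deg b) (u b)"
  have U: "?U u \<in> S \<rightarrow>\<^sub>E carrier A" if "u \<in> S \<rightarrow>\<^sub>E carrier A" for u
    using that by (auto intro!: \<theta>_closed)
  have sum: "(\<Oplus>\<^bsub>M\<^esub>b\<in>S. u b \<odot>\<^bsub>twist_module \<theta> M\<^esub> b) = (\<Oplus>\<^bsub>M\<^esub>b\<in>S. ?U u b \<odot>\<^bsub>M\<^esub> b)"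
    if u: "u \<in> S \<rightarrow>\<^sub>E carrier A" for u
    by (rule M.finsum_cong')
      (use u S(2) in \<open>auto intro!: M.act_closed \<theta>_closed twist_act hom\<close>)
  have "\<exists>!u. u \<in> S \<rightarrow>\<^sub>E carrier A \<and> v = (\<Oplus>\<^bsub>M\<^esub>b\<in>S. u b \<odot>\<^bsub>twist_module \<theta> M\<^esub> b)"
    if v: "v \<in> carrier M" for v
  proof -
    obtain u where u: "u \<in> S \<rightarrow>\<^sub>E carrier A" "v = (\<Oplus>\<^bsub>M\<^esub>b\<in>S. u b \<odot>\<^bsub>M\<^esub> b)"
      using ex1[OF v] by blast
    \<comment> \<open>The old coefficients sent back by the inverse bijections, so that
      \<open>?U ?w\<close> is again \<open>u\<close>.\<close>
    let ?w = "\<lambda>b\<in>S. \<theta>' (deg b) (u b)"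
    have w: "?w \<in> S \<rightarrow>\<^sub>E carrier A"
      using u(1) by (auto intro!: \<theta>_inv_closed)
    have "?U ?w = u"
    proof
      fix b
      show "?U ?w b = u b"
        using \<theta>_inv_right[OF PiE_mem[OF u(1)]] PiE_arb[OF u(1)] by (cases "b \<in> S") simp_all
    qed
    then have "v = (\<Oplus>\<^bsub>M\<^esub>b\<in>S. ?w b \<odot>\<^bsub>twist_module \<theta> M\<^esub> b)"
      using u(2) sum[OF w] by simp
    moreover have "u1 = u2"
      if "u1 \<in> S \<rightarrow>\<^sub>E carrier A" "v = (\<Oplus>\<^bsub>M\<^esub>b\<in>S. u1 b \<odot>\<^bsub>twist_module \<theta> M\<^esub> b)"
        and "u2 \<in> S \<rightarrow>\<^sub>E carrier A" "v = (\<Oplus>\<^bsub>M\<^esub>b\<in>S. u2 b \<odot>\<^bsub>twist_module \<theta> M\<^esub> b)" for u1 u2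
    proof (rule PiE_ext[OF that(1,3)])
      fix b assume b: "b \<in> S"
      have "?U u1 = ?U u2"
        using ex1[OF v] U[OF that(1)] U[OF that(3)] sum[OF that(1)] sum[OF that(3)] that(2,4) by metis
      from fun_cong[OF this, of b] have "\<theta> (deg b) (u1 b) = \<theta> (deg b) (u2 b)"
        using b by simp
      then show "u1 b = u2 b"
        by (rule \<theta>_eqD) (use that(1,3) b in \<open>auto simp: PiE_mem\<close>)
    qed
    ultimately show ?thesis
      using w by blast
  qed
  then show ?thesis
    using S by (simp add: finite_basis_def same fs)
qed

end

section \<open>Free modules and homomorphisms under twisting; the twist undone\<close>

context ring_twist
begin

lemma fg_graded_free_twist:
  assumes "fg_graded_free A M"
  shows "fg_graded_free B (twist_module \<theta> M)"
proof -
  interpret graded_left_module A M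
    using assms by (simp add: fg_graded_free_def)
  interpret twisted_module A B \<theta> \<theta>' M ..
  obtain S where S: "finite_basis A M (carrier M) S" "\<forall>b\<in>S. \<exists>i. b \<in> grade M i"
    using assms by (auto simp: fg_graded_free_def)
  then obtain deg where "\<forall>b\<in>S. b \<in> grade M (deg b)"
    by metis
  then have "finite_basis B (twist_module \<theta> M) (carrier M) S"
    using finite_basis_twist[OF S(1)] by blast
  then show ?thesis
    using graded_left_module_twist S(2) by (auto simp: fg_graded_free_def)
qed

text \<open>A homomorphism of degree 0 keeps the degree \<open>i\<close> of \<open>x\<close>, so
  \<open>a\<close> acts on \<open>x\<close> and on \<open>\<phi> x\<close> through the same
  \<open>\<theta> i a\<close>.\<close>

lemma graded_hom_twist:
  assumes M: "graded_left_module A M" and N: "graded_left_module A N"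
    and \<phi>: "\<phi> \<in> graded_hom A M N"
  shows "\<phi> \<in> graded_hom B (twist_module \<theta> M) (twist_module \<theta> N)"
proof -
  interpret M: twisted_module A B \<theta> \<theta>' M
    using M by (simp add: twisted_module_def ring_twist_axioms)
  interpret N: twisted_module A B \<theta> \<theta>' N
    using N by (simp add: twisted_module_def ring_twist_axioms)
  have "\<phi> (a \<odot>\<^bsub>twist_module \<theta> M\<^esub> x) = a \<odot>\<^bsub>twist_module \<theta> N\<^esub> \<phi> x"
    if a: "a \<in> carrier A" and x: "x \<in> carrier M" for a x
    using x
  proof (induction x rule: M.M.homogeneous_induct)
    case (homogeneous i x)
    then show ?case
      using a graded_homD(3)[OF \<phi>] N.twist_act[OF a graded_homD(4)[OF \<phi> homogeneous]]
      by (simp add: M.twist_act \<theta>_closed M.M.grade_closed)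
  next
    case (add x y)
    then show ?case
      using a graded_homD[OF \<phi>]
      by (simp add: M.twist_act_add N.twist_act_add M.twist_act_closed)
  qed
  then show ?thesis
    using graded_homD[OF \<phi>] by (intro graded_homI) (simp_all add: same)
qed

text \<open>Twisting keeps the degree of \<open>x\<close>, so the two twists combine to
  \<open>\<theta> i (\<theta>' i a)\<close>.\<close>

lemma twist_twist_act:
  assumes M: "graded_left_module A M" and a: "a \<in> carrier A" and x: "x \<in> carrier M"
  shows "a \<odot>\<^bsub>twist_module \<theta>' (twist_module \<theta> M)\<^esub> x = a \<odot>\<^bsub>M\<^esub> x"
proof -
  interpret M: twisted_module A B \<theta> \<theta>' M
    using M by (simp add: twisted_module_def ring_twist_axioms)
  interpret T: twisted_module B A \<theta>' \<theta> "twist_module \<theta> M"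
    using M.graded_left_module_twist inverse_twist by (simp add: twisted_module_def)
  show ?thesis
    using x
  proof (induction x rule: M.M.homogeneous_induct)
    case (homogeneous i x)
    then show ?case
      using a by (simp add: T.twist_act same M.twist_act \<theta>_inv_closed \<theta>_inv_right)
  next
    case (add x y)
    then show ?case
      using a T.twist_act_add[of a x y] by (simp add: same M.M.act_add_right)
  qed
qed

end

section \<open>Twisting factorizations\<close>

text \<open>The central units \<open>u n\<close> and \<open>v n\<close> stand for the scalar \<open>c\<^sup>n\<close> in \<open>A\<close> and for \<open>c\<^sup>-\<^sup>n\<close> in \<open>B\<close>;
  with these the hypotheses are again symmetric in \<open>A\<close> and \<open>B\<close>.\<close>

locale factorization_twist = ring_twist A B \<theta> \<theta>'
  for A B :: "('k, 'a) graded_module" and \<theta> \<theta>' +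
  fixes f :: 'a and d :: nat and \<sigma> \<sigma>' :: "'a \<Rightarrow> 'a" and u v :: "int \<Rightarrow> 'a"
  assumes f: "f \<in> grade A (int d)"
    and \<sigma>_closed: "x \<in> carrier A \<Longrightarrow> \<sigma> x \<in> carrier A" "x \<in> carrier A \<Longrightarrow> \<sigma>' x \<in> carrier A"
    and \<sigma>_add:
      "\<lbrakk>x \<in> carrier A; y \<in> carrier A\<rbrakk> \<Longrightarrow> \<sigma> (x \<oplus>\<^bsub>A\<^esub> y) = \<sigma> x \<oplus>\<^bsub>A\<^esub> \<sigma> y"
      "\<lbrakk>x \<in> carrier A; y \<in> carrier A\<rbrakk> \<Longrightarrow> \<sigma>' (x \<oplus>\<^bsub>A\<^esub> y) = \<sigma>' x \<oplus>\<^bsub>A\<^esub> \<sigma>' y"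
    and \<sigma>_grade: "x \<in> grade A i \<Longrightarrow> \<sigma> x \<in> grade A i" "x \<in> grade A i \<Longrightarrow> \<sigma>' x \<in> grade A i"
    and u_grade: "u n \<in> grade A 0" and v_grade: "v n \<in> grade A 0"
    and \<theta>_v: "\<theta> k (v n) = u (- n)"
    and u_zero: "u 0 = \<one>\<^bsub>A\<^esub>" and u_add: "u (m + n) = u m \<otimes>\<^bsub>A\<^esub> u n"
    and u_commute: "x \<in> carrier A \<Longrightarrow> u n \<otimes>\<^bsub>A\<^esub> x = x \<otimes>\<^bsub>A\<^esub> u n"
    and \<sigma>_u: "\<sigma> (u n) = u n"
    and \<theta>_f: "\<theta> n f = u n \<otimes>\<^bsub>A\<^esub> f"
    and \<theta>_\<sigma>: "x \<in> grade A i \<Longrightarrow> \<theta> n (\<sigma>' x) = u (- i) \<otimes>\<^bsub>A\<^esub> \<sigma> (\<theta> (n + int d) x)"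
begin

lemma u_closed: "u n \<in> carrier A" and v_closed: "v n \<in> carrier A" and f_closed: "f \<in> carrier A"
  using u_grade v_grade f A.grade_closed by blast+

lemma u_cancel: "u n \<otimes>\<^bsub>A\<^esub> u (- n) = \<one>\<^bsub>A\<^esub>" "u (- n) \<otimes>\<^bsub>A\<^esub> u n = \<one>\<^bsub>A\<^esub>"
  by (simp_all flip: u_add u_zero)

text \<open>For \<open>x\<close> of degree \<open>i\<close>, \<open>\<theta> 0\<close> carries
  \<open>v n * x\<close> to \<open>\<theta> i (v n) \<cdot> \<theta> 0 x\<close> and
  \<open>x * v n\<close> to \<open>\<theta> 0 x \<cdot> \<theta> 0 (v n)\<close>. Both images of
  \<open>v n\<close> are \<open>u (- n)\<close>, because \<open>\<theta> k (v n)\<close> does not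
  depend on \<open>k\<close>, and \<open>u (- n)\<close> is central in \<open>A\<close>.\<close>

lemma v_commute:
  assumes "x \<in> carrier A"
  shows "v n \<otimes>\<^bsub>B\<^esub> x = x \<otimes>\<^bsub>B\<^esub> v n"
  using assms
proof (induction x rule: A.homogeneous_induct)
  case (homogeneous i x)
  then show ?case
    using \<theta>_mult[OF v_closed homogeneous, of 0 n]
      \<theta>_mult[OF A.grade_closed[OF homogeneous] v_grade, of 0 n]
    by - (rule \<theta>_eqD[of 0],
      simp_all add: \<theta>_v mult_closed v_closed A.grade_closed u_commute \<theta>_closed)
next
  case (add x y)
  then show ?case
    using B.l_distr[of x y "v n"] B.r_distr[of x y "v n"] by (simp add: same v_closed)
qed

text \<open>The laws of the exchanged data are tested under an injective \<open>\<theta> n\<close>,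
  which turns them into laws for \<open>u\<close> and \<open>\<sigma>\<close>. The rule for
  \<open>f\<close> explains the sign in \<open>\<theta> k (v n) = u (- n)\<close>: applying
  \<open>\<theta> n\<close> to \<open>v n * f\<close> gives
  \<open>u (- n) \<cdot> u n \<cdot> f\<close>, where the units cancel.\<close>

lemma inverse_factorization_twist: "factorization_twist B A \<theta>' \<theta> f d \<sigma>' \<sigma> v u"
proof -
  interpret I: ring_twist B A \<theta>' \<theta>
    by (rule inverse_twist)
  show ?thesis
  proof
    show "v (m + n) = v m \<otimes>\<^bsub>B\<^esub> v n" for m n
      by (rule \<theta>_eqD[of 0])
        (simp_all add: \<theta>_mult[OF v_closed v_grade] \<theta>_v v_closed mult_closed flip: u_add)
    show "\<theta>' n f = v n \<otimes>\<^bsub>B\<^esub> f" for n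
      by (rule \<theta>_eqD[of n])
        (simp_all add: \<theta>_mult[OF v_closed f] \<theta>_v \<theta>_f v_closed u_closed f_closed mult_closed
          \<theta>_inv_closed \<theta>_inv_right u_cancel flip: A.m_assoc)
    show "\<theta>' n (\<sigma> x) = v (- i) \<otimes>\<^bsub>B\<^esub> \<sigma>' (\<theta>' (n + int d) x)" if "x \<in> grade B i" for n i x
    proof -
      \<comment> \<open>Chosen so that \<open>\<theta> (n + int d) ?y\<close> is \<open>x\<close>;
        by \<open>\<theta>_\<sigma>\<close> for \<open>?y\<close> the factors \<open>u i\<close> and
        \<open>u (- i)\<close> then cancel.\<close>
      let ?y = "\<theta>' (n + int d) x"
      have x: "x \<in> grade A i" "x \<in> carrier A"
        using that A.grade_closed by (auto simp: same)
      then have y: "?y \<in> grade A i"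
        by (simp add: \<theta>_inv_grade)
      show ?thesis
        by (rule \<theta>_eqD[of n])
          (simp_all add: \<theta>_mult[OF v_closed \<sigma>_grade(2)[OF y]] \<theta>_v \<theta>_\<sigma>[OF y] x \<theta>_inv_right
            \<theta>_inv_closed \<sigma>_closed mult_closed v_closed u_closed u_cancel flip: A.m_assoc)
    qed
    show "\<theta>' k (u n) = v (- n)" for k n
      by (rule \<theta>_eqD[of k]) (simp_all add: \<theta>_v \<theta>_inv_closed \<theta>_inv_right u_closed v_closed)
    show "v 0 = \<one>\<^bsub>B\<^esub>"
      by (rule \<theta>_eqD[of 0]) (simp_all add: \<theta>_v \<theta>_one u_zero v_closed one_closed)
    show "\<sigma>' (v n) = v n" for n
      by (rule \<theta>_eqD[of 0])
        (simp_all add: \<theta>_\<sigma>[OF v_grade] \<theta>_v \<sigma>_u u_zero u_closed v_closed \<sigma>_closed)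
    show "v n \<otimes>\<^bsub>B\<^esub> x = x \<otimes>\<^bsub>B\<^esub> v n" if "x \<in> carrier B" for x n
      using that by (simp add: same v_commute)
  qed (simp_all add: same f \<sigma>_closed \<sigma>_add \<sigma>_grade u_grade v_grade)
qed

text \<open>The exponent \<open>n\<close> is the degree of \<open>x\<close> in \<open>tgt X\<close>;
  in the shifted module on which \<open>tau X\<close> is a homomorphism, \<open>x\<close> has degree
  \<open>n + d\<close>. The scalar acts by the old action of \<open>src X\<close>, not by the
  twisted one.\<close>

definition twist_factorization :: "('a, 'm) factorization \<Rightarrow> ('a, 'm) factorization" where
  "twist_factorization X = \<lparr>src = twist_module \<theta> (src X), tgt = twist_module \<theta> (tgt X), phi = phi X,
     tau = (\<lambda>x\<in>carrier (tgt X).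
       additive_extension (tgt X) (src X) (\<lambda>n x. u n \<odot>\<^bsub>src X\<^esub> tau X x) x)\<rparr>"

lemma twist_factorization_simps [simp]:
  "src (twist_factorization X) = twist_module \<theta> (src X)"
  "tgt (twist_factorization X) = twist_module \<theta> (tgt X)"
  "phi (twist_factorization X) = phi X"
  by (simp_all add: twist_factorization_def)

lemma twisted_factorization_twist:
  assumes X: "twisted_factorization A f d \<sigma> X"
  shows "twisted_factorization B f d \<sigma>' (twist_factorization X)"
proof -
  note XD = twisted_factorizationD[OF X]
  interpret F: twisted_module A B \<theta> \<theta>' "src X"
    using XD(1) by (simp add: twisted_module_def ring_twist_axioms)
  interpret G: twisted_module A B \<theta> \<theta>' "tgt X"
    using XD(2) by (simp add: twisted_module_def ring_twist_axioms)
  note phi = graded_homD[OF XD(3)]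
  have tau_closed: "x \<in> carrier (tgt X) \<Longrightarrow> tau X x \<in> carrier (src X)"
    and tau_add: "\<lbrakk>x \<in> carrier (tgt X); y \<in> carrier (tgt X)\<rbrakk> \<Longrightarrow>
      tau X (x \<oplus>\<^bsub>tgt X\<^esub> y) = tau X x \<oplus>\<^bsub>src X\<^esub> tau X y"
    and tau_act: "\<lbrakk>a \<in> carrier A; x \<in> carrier (tgt X)\<rbrakk> \<Longrightarrow>
      tau X (\<sigma> a \<odot>\<^bsub>tgt X\<^esub> x) = a \<odot>\<^bsub>src X\<^esub> tau X x" for x y a
    using graded_homD[OF XD(4)] by (simp_all add: tw_def)
  have tau_grade: "tau X x \<in> grade (src X) (i + int d)" if "x \<in> grade (tgt X) i" for x i
    using graded_homD(4)[OF XD(4), of x "i + int d"] that by (simp add: tw_def)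
  interpret T: homogeneous_additive "tgt X" "src X" "\<lambda>n x. u n \<odot>\<^bsub>src X\<^esub> tau X x"
    by unfold_locales
      (simp_all add: u_closed F.M.act_closed F.M.act_add_right tau_closed tau_add G.M.grade_closed)
  define \<tau> where "\<tau> = tau (twist_factorization X)"
  have \<tau>_hom: "\<tau> x = u n \<odot>\<^bsub>src X\<^esub> tau X x" if "x \<in> grade (tgt X) n" for x n
    using that G.M.grade_closed[OF that]
    by (simp add: \<tau>_def twist_factorization_def T.extension_homogeneous)
  have \<tau>_closed: "\<tau> x \<in> carrier (src X)" if "x \<in> carrier (tgt X)" for x
    using that by (simp add: \<tau>_def twist_factorization_def T.extension_closed)
  have \<tau>_add: "\<tau> (x \<oplus>\<^bsub>tgt X\<^esub> y) = \<tau> x \<oplus>\<^bsub>src X\<^esub> \<tau> y"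
    if "x \<in> carrier (tgt X)" "y \<in> carrier (tgt X)" for x y
    using that by (simp add: \<tau>_def twist_factorization_def T.extension_add)
  have \<tau>_grade: "\<tau> x \<in> grade (src X) (n + int d)" if "x \<in> grade (tgt X) n" for x n
    using F.M.act_grade[OF u_grade tau_grade[OF that]] by (simp add: \<tau>_hom[OF that])

  have act_hom: "\<tau> (\<sigma>' a \<odot>\<^bsub>twist_module \<theta> (tgt X)\<^esub> x) = a \<odot>\<^bsub>twist_module \<theta> (src X)\<^esub> \<tau> x"
    if a: "a \<in> grade A l" and x: "x \<in> grade (tgt X) n" for a x l n
  proof -
    let ?a = "\<theta> (n + int d) a"
    have c: "a \<in> carrier A" "x \<in> carrier (tgt X)" "?a \<in> carrier A"
      using a x A.grade_closed G.M.grade_closed \<theta>_closed by auto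
    have g: "\<theta> n (\<sigma>' a) \<odot>\<^bsub>tgt X\<^esub> x \<in> grade (tgt X) (l + n)"
      using G.M.act_grade[OF \<theta>_grade[OF \<sigma>_grade(2)[OF a]] x] .
    \<comment> \<open>\<open>\<sigma>\<close> fixes \<open>u (- l)\<close>. Written as
      \<open>\<sigma> (u (- l))\<close>, this factor too can be pulled through \<open>tau X\<close>,
      which replaces the action of \<open>\<sigma> b\<close> by that of \<open>b\<close>.\<close>
    have "\<theta> n (\<sigma>' a) \<odot>\<^bsub>tgt X\<^esub> x = \<sigma> (u (- l)) \<odot>\<^bsub>tgt X\<^esub> (\<sigma> ?a \<odot>\<^bsub>tgt X\<^esub> x)"
      using c by (simp add: \<theta>_\<sigma>[OF a] \<sigma>_u G.M.act_mult u_closed \<sigma>_closed)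
    then have "tau X (\<theta> n (\<sigma>' a) \<odot>\<^bsub>tgt X\<^esub> x) = u (- l) \<odot>\<^bsub>src X\<^esub> (?a \<odot>\<^bsub>src X\<^esub> tau X x)"
      using c by (simp add: tau_act u_closed \<sigma>_closed G.M.act_closed)
    \<comment> \<open>The argument of \<open>\<tau>\<close> has degree \<open>l + n\<close>, hence
      the exponent; \<open>u (l + n)\<close> and \<open>u (- l)\<close> will leave
      \<open>u n\<close>.\<close>
    then have "\<tau> (\<sigma>' a \<odot>\<^bsub>twist_module \<theta> (tgt X)\<^esub> x)
        = u (l + n) \<odot>\<^bsub>src X\<^esub> (u (- l) \<odot>\<^bsub>src X\<^esub> (?a \<odot>\<^bsub>src X\<^esub> tau X x))"
      using \<tau>_hom[OF g] c x by (simp add: G.twist_act \<sigma>_closed)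
    also have "\<dots> = (u (l + n) \<otimes>\<^bsub>A\<^esub> u (- l)) \<odot>\<^bsub>src X\<^esub> (?a \<odot>\<^bsub>src X\<^esub> tau X x)"
      using c by (simp add: F.M.act_mult u_closed F.M.act_closed tau_closed)
    also have "\<dots> = (?a \<otimes>\<^bsub>A\<^esub> u n) \<odot>\<^bsub>src X\<^esub> tau X x"
      using c by (simp add: F.M.act_mult u_closed tau_closed flip: u_add u_commute)
    also have "\<dots> = a \<odot>\<^bsub>twist_module \<theta> (src X)\<^esub> \<tau> x"
      using c F.twist_act[OF c(1) \<tau>_grade[OF x]]
      by (simp add: F.M.act_mult u_closed tau_closed \<tau>_hom[OF x])
    finally show ?thesis .
  qed
  have act: "\<tau> (\<sigma>' a \<odot>\<^bsub>twist_module \<theta> (tgt X)\<^esub> x) = a \<odot>\<^bsub>twist_module \<theta> (src X)\<^esub> \<tau> x"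
    if a: "a \<in> carrier A" and x: "x \<in> carrier (tgt X)" for a x
    using x
  proof (induction x rule: G.M.homogeneous_induct)
    case (homogeneous n x)
    then have x: "x \<in> carrier (tgt X)"
      by (rule G.M.grade_closed)
    from a show ?case
    proof (induction a rule: A.homogeneous_induct)
      case (add a b)
      then show ?case
        using x by (simp add: \<sigma>_add \<sigma>_closed G.twist_add_act F.twist_add_act \<tau>_add \<tau>_closed
            G.twist_act_closed)
    qed (rule act_hom[OF _ homogeneous])
  next
    case (add x y)
    then show ?case
      using a by (simp add: G.twist_act_add F.twist_act_add \<sigma>_closed \<tau>_add \<tau>_closed
          G.twist_act_closed)
  qed
  have \<tau>_graded_hom: "\<tau> \<in> graded_hom B (tw d \<sigma>' (twist_module \<theta> (tgt X))) (twist_module \<theta> (src X))"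
  proof (rule graded_homI)
    show "\<tau> \<in> extensional (carrier (tw d \<sigma>' (twist_module \<theta> (tgt X))))"
      by (simp add: \<tau>_def twist_factorization_def tw_def)
    show "\<tau> x \<in> grade (twist_module \<theta> (src X)) i"
      if "x \<in> grade (tw d \<sigma>' (twist_module \<theta> (tgt X))) i" for i x
      using \<tau>_grade[of x "i - int d"] that by (simp add: tw_def)
  qed (simp_all add: tw_def same \<tau>_closed \<tau>_add act)

  \<comment> \<open>Both composites reduce to this: in degree \<open>n\<close> the element
    \<open>f\<close> acts in the twist through \<open>\<theta> n f\<close>, which is
    \<open>u n\<close> times \<open>f\<close>.\<close>
  have f_twist: "u n \<odot>\<^bsub>M\<^esub> (f \<odot>\<^bsub>M\<^esub> x) = f \<odot>\<^bsub>twist_module \<theta> M\<^esub> x"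
    if M: "twisted_module A B \<theta> \<theta>' M" and x: "x \<in> grade M n" for M :: "('a, 'm) graded_module" and x n
  proof -
    interpret M: twisted_module A B \<theta> \<theta>' M by fact
    show ?thesis
      using M.M.grade_closed[OF x]
      by (simp add: M.twist_act[OF f_closed x] \<theta>_f M.M.act_mult u_closed f_closed)
  qed
  have phi_\<tau>: "phi X (\<tau> x) = f \<odot>\<^bsub>twist_module \<theta> (tgt X)\<^esub> x" if "x \<in> carrier (tgt X)" for x
    using that
  proof (induction x rule: G.M.homogeneous_induct)
    case (homogeneous n x)
    then have x: "x \<in> carrier (tgt X)"
      by (rule G.M.grade_closed)
    show ?case
      using x f_twist[OF G.twisted_module_axioms homogeneous]
      by (simp add: \<tau>_hom[OF homogeneous] phi(3) u_closed tau_closed XD(5))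
  next
    case (add x y)
    then show ?case
      by (simp add: \<tau>_add \<tau>_closed phi(2) G.twist_act_add f_closed)
  qed
  have \<tau>_phi: "\<tau> (phi X x) = f \<odot>\<^bsub>twist_module \<theta> (src X)\<^esub> x" if "x \<in> carrier (src X)" for x
    using that
  proof (induction x rule: F.M.homogeneous_induct)
    case (homogeneous n x)
    then show ?case
      using f_twist[OF F.twisted_module_axioms homogeneous] F.M.grade_closed[OF homogeneous]
      by (simp add: \<tau>_hom[OF phi(4)] XD(6))
  next
    case (add x y)
    then show ?case
      by (simp add: \<tau>_add phi(1,2) F.twist_act_add f_closed)
  qed
  have "compose (carrier (tgt X)) (phi X) \<tau> = left_mult f (twist_module \<theta> (tgt X))"
    "compose (carrier (src X)) \<tau> (phi X) = left_mult f (twist_module \<theta> (src X))"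
    by (auto simp: compose_def left_mult_def phi_\<tau> \<tau>_phi)
  then show ?thesis
    using \<tau>_graded_hom X graded_hom_twist[OF XD(1,2,3)]
    by (simp add: twisted_factorization_def fg_graded_free_twist flip: \<tau>_def)
qed

lemma factorization_hom_twist:
  assumes "twisted_factorization A f d \<sigma> X" "twisted_factorization A f d \<sigma> Y"
    and "\<psi> \<in> factorization_hom A X Y"
  shows "\<psi> \<in> factorization_hom B (twist_factorization X) (twist_factorization Y)"
proof -
  obtain \<psi>G \<psi>F where eq: "\<psi> = (\<psi>G, \<psi>F)"
    by (cases \<psi>)
  note \<psi> = factorization_homD[OF assms(3)[unfolded eq]]
  show ?thesis
    unfolding eq
    using graded_hom_twist[OF twisted_factorizationD(2)[OF assms(1)]
        twisted_factorizationD(2)[OF assms(2)] \<psi>(1)]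
      graded_hom_twist[OF twisted_factorizationD(1)[OF assms(1)]
        twisted_factorizationD(1)[OF assms(2)] \<psi>(2)]
    by (rule factorization_homI[where X = "twist_factorization X" and Y = "twist_factorization Y",
          simplified]) (simp add: \<psi>(3))
qed

section \<open>The twist as a functor and its quasi-inverse\<close>

lemma is_functor_twist:
  "is_functor (TMF A f d \<sigma>) (TMF B f d \<sigma>') twist_factorization (\<lambda>X Y \<psi>. \<psi>)"
  unfolding is_functor_def
  by (auto simp: TMF_def twisted_factorization_twist intro: factorization_hom_twist)

abbreviation untwist_factorization :: "('a, 'm) factorization \<Rightarrow> ('a, 'm) factorization" where
  "untwist_factorization \<equiv> factorization_twist.twist_factorization \<theta>' v"

text \<open>\<open>factorization_hom\<close> tests the module maps against \<open>phi\<close>, which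
  both twists leave unchanged. The maps \<open>tau\<close> are not compared, so the scalars of the
  two twists need not be multiplied out.\<close>

lemma factorization_hom_twist_twist:
  assumes X: "twisted_factorization A f d \<sigma> X"
  shows "ident (TMF A f d \<sigma>) X
      \<in> factorization_hom A X (untwist_factorization (twist_factorization X))"
    and "ident (TMF A f d \<sigma>) X
      \<in> factorization_hom A (untwist_factorization (twist_factorization X)) X"
proof -
  interpret I: factorization_twist B A \<theta>' \<theta> f d \<sigma>' \<sigma> v u
    by (rule inverse_factorization_twist)
  note XD = twisted_factorizationD[OF X]
  note id = graded_hom_ident[where N = "twist_module \<theta>' (twist_module \<theta> M)" and M = M and A = A
      for M, simplified, OF _ twist_twist_act]
  have "phi X x \<in> carrier (tgt X)" if "x \<in> carrier (src X)" for x
    using graded_homD(1)[OF XD(3) that] .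
  then show "ident (TMF A f d \<sigma>) X
      \<in> factorization_hom A X (untwist_factorization (twist_factorization X))"
    "ident (TMF A f d \<sigma>) X
      \<in> factorization_hom A (untwist_factorization (twist_factorization X)) X"
    using id[OF XD(1) XD(1)] id[OF XD(2) XD(2)]
    by (auto simp: TMF_def intro!: factorization_homI)
qed

text \<open>Both directions occur because the unit of an equivalence starts at the identity functor
  and the counit ends there. The second one is applied with \<open>A\<close> and \<open>B\<close>
  exchanged.\<close>

lemma natural_isomorphism_twist_twist:
  "is_natural_isomorphism (TMF A f d \<sigma>) (TMF A f d \<sigma>)
     (\<lambda>X :: ('a, 'm) factorization. X) (\<lambda>X Y \<psi>. \<psi>)
     (\<lambda>X. untwist_factorization (twist_factorization X)) (\<lambda>X Y \<psi>. \<psi>) (ident (TMF A f d \<sigma>))"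
  "is_natural_isomorphism (TMF A f d \<sigma>) (TMF A f d \<sigma>)
     (\<lambda>X. untwist_factorization (twist_factorization X)) (\<lambda>X Y \<psi>. \<psi>)
     (\<lambda>X :: ('a, 'm) factorization. X) (\<lambda>X Y \<psi>. \<psi>)
     (ident (TMF A f d \<sigma>))"
proof -
  interpret I: factorization_twist B A \<theta>' \<theta> f d \<sigma>' \<sigma> v u
    by (rule inverse_factorization_twist)
  let ?C = "TMF A f d \<sigma> :: (('a, 'm) factorization, _) category"
    and ?T = "\<lambda>X. untwist_factorization (twist_factorization X)"
  define comp where "comp X = composite ?C X X X" for X
  \<comment> \<open>Composition refers to its objects only through the carriers of the first one,
    which twisting keeps. So the unit laws of the category give both the inverses and
    naturality.\<close>
  have comp: "composite ?C X Y Z = comp X" "comp (?T X) = comp X" for X Y Z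
    by (simp_all add: comp_def TMF_def)
  interpret C: is_category ?C
    by (rule is_category_TMF)
  have iso: "is_isomorphism ?C X (?T X) (ident ?C X)" "is_isomorphism ?C (?T X) X (ident ?C X)"
    if X: "X \<in> obj ?C" for X
  proof -
    have "ident ?C X = ident ?C (?T X)"
      by (simp add: TMF_def)
    moreover have "composite ?C X (?T X) X (ident ?C X) (ident ?C X) = ident ?C X"
      "composite ?C (?T X) X (?T X) (ident ?C X) (ident ?C X) = ident ?C X"
      using C.ident_right[OF X X C.ident_hom[OF X]]
      by (simp_all add: comp)
    moreover have "ident ?C X \<in> hom_set ?C X (?T X)" "ident ?C X \<in> hom_set ?C (?T X) X"
      using factorization_hom_twist_twist X by (auto simp: TMF_def)
    ultimately show "is_isomorphism ?C X (?T X) (ident ?C X)"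
      "is_isomorphism ?C (?T X) X (ident ?C X)"
      unfolding is_isomorphism_def by metis+
  qed
  have nat: "composite ?C X Y (?T Y) (ident ?C Y) \<psi> = composite ?C X (?T X) (?T Y) \<psi> (ident ?C X)"
    "composite ?C (?T X) (?T Y) Y (ident ?C Y) \<psi> = composite ?C (?T X) X Y \<psi> (ident ?C X)"
    if "X \<in> obj ?C" "Y \<in> obj ?C" "\<psi> \<in> hom_set ?C X Y" for X Y \<psi>
    using C.ident_left[OF that] C.ident_right[OF that]
    by (simp_all add: comp)
  show "is_natural_isomorphism ?C ?C (\<lambda>X. X) (\<lambda>X Y \<psi>. \<psi>) ?T (\<lambda>X Y \<psi>. \<psi>) (ident ?C)"
    "is_natural_isomorphism ?C ?C ?T (\<lambda>X Y \<psi>. \<psi>) (\<lambda>X. X) (\<lambda>X Y \<psi>. \<psi>) (ident ?C)"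
    unfolding is_natural_isomorphism_def using iso nat by blast+
qed

end

lemma (in factorization_twist) equivalent_categories_twist:
  "equivalent_categories
    (TMF A f d \<sigma> :: (('a, 'm) factorization, ('m \<Rightarrow> 'm) \<times> ('m \<Rightarrow> 'm)) category)
    (TMF B f d \<sigma>' :: (('a, 'm) factorization, ('m \<Rightarrow> 'm) \<times> ('m \<Rightarrow> 'm)) category)"
proof -
  interpret I: factorization_twist B A \<theta>' \<theta> f d \<sigma>' \<sigma> v u
    by (rule inverse_factorization_twist)
  show ?thesis
    unfolding equivalent_categories_def
  proof (intro conjI is_category_TMF exI)
    show "is_functor (TMF A f d \<sigma>) (TMF B f d \<sigma>') twist_factorization (\<lambda>X Y \<psi>. \<psi>)"
      by (rule is_functor_twist)
    show "is_functor (TMF B f d \<sigma>') (TMF A f d \<sigma>) untwist_factorization (\<lambda>X Y \<psi>. \<psi>)"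
      by (rule I.is_functor_twist)
  qed (rule natural_isomorphism_twist_twist(1) I.natural_isomorphism_twist_twist(2))+
qed

section \<open>Zhang twists\<close>

lemma zhang_twist_simps [simp]:
  "carrier (zhang_twist A \<zeta>) = carrier A" "add (zhang_twist A \<zeta>) = add A"
  "zero (zhang_twist A \<zeta>) = zero A" "grade (zhang_twist A \<zeta>) = grade A"
  "smult (zhang_twist A \<zeta>) = smult A"
  by (simp_all add: zhang_twist_def)

lemma graded_linear_automorphismD:
  assumes "graded_linear_automorphism K A \<theta>"
  shows "bij_betw \<theta> (carrier A) (carrier A)"
    and "\<lbrakk>x \<in> carrier A; y \<in> carrier A\<rbrakk> \<Longrightarrow> \<theta> (x \<oplus>\<^bsub>A\<^esub> y) = \<theta> x \<oplus>\<^bsub>A\<^esub> \<theta> y"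
    and "\<lbrakk>\<alpha> \<in> carrier K; x \<in> carrier A\<rbrakk> \<Longrightarrow> \<theta> (\<alpha> \<odot>\<^bsub>A\<^esub> x) = \<alpha> \<odot>\<^bsub>A\<^esub> \<theta> x"
    and "x \<in> grade A i \<Longrightarrow> \<theta> x \<in> grade A i"
  using assms unfolding graded_linear_automorphism_def by blast+

text \<open>A degree-preserving additive bijection commutes with taking homogeneous components, so its
  inverse preserves degrees too.\<close>

lemma (in graded_group) inv_into_grade:
  assumes bij: "bij_betw \<theta> (carrier M) (carrier M)"
    and add: "\<And>x y. \<lbrakk>x \<in> carrier M; y \<in> carrier M\<rbrakk> \<Longrightarrow> \<theta> (x \<oplus> y) = \<theta> x \<oplus> \<theta> y"
    and grade: "\<And>i x. x \<in> grade M i \<Longrightarrow> \<theta> x \<in> grade M i"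
    and y: "y \<in> grade M i"
  shows "inv_into (carrier M) \<theta> y \<in> grade M i"
proof -
  define x where "x = inv_into (carrier M) \<theta> y"
  have x: "x \<in> carrier M" "\<theta> x = y"
    using bij bij_betw_imp_surj_on[OF bij] grade_closed[OF y]
    by (auto simp: x_def inv_into_into f_inv_into_f)
  have \<theta>_closed: "\<theta> z \<in> carrier M" if "z \<in> carrier M" for z
    using bij that by (rule bij_betw_apply)
  have comp: "hcomp M (\<theta> z) j = \<theta> (hcomp M z j)" if "z \<in> carrier M" for z j
    using that
  proof (induction z rule: homogeneous_induct)
    case (homogeneous k z)
    have "\<theta> \<zero> \<oplus> \<theta> \<zero> = \<theta> \<zero>"
      using add[of \<zero> \<zero>] by simp
    then have "\<theta> \<zero> = \<zero>"
      using \<theta>_closed[of \<zero>] by (metis add.r_cancel_one' zero_closed)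
    then show ?case
      by (simp add: hcomp_homogeneous[OF homogeneous] hcomp_homogeneous[OF grade[OF homogeneous]])
  next
    case (add z w)
    then show ?case
      by (simp add: hcomp_add assms(2) \<theta>_closed hcomp_closed)
  qed
  have "\<theta> (hcomp M x i) = \<theta> x"
    using comp[OF x(1), of i] hcomp_homogeneous[OF y] x(2) by simp
  then have "hcomp M x i = x"
    using bij x(1) hcomp_closed[OF x(1)] by (meson bij_betw_imp_inj_on inj_onD)
  then show ?thesis
    using hcomp_grade[OF x(1), of i] by (simp add: x_def)
qed

section \<open>The ring structure of the Zhang twist\<close>

context connected_graded_algebra
begin

lemma one_grade: "\<one>\<^bsub>A\<^esub> \<in> grade A 0"
proof -
  have "\<one>\<^bsub>A\<^esub> = \<one>\<^bsub>K\<^esub> \<odot>\<^bsub>A\<^esub> \<one>\<^bsub>A\<^esub>"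
    by simp
  then show ?thesis
    using connected(2) K.one_closed by blast
qed

context
  fixes \<zeta> :: "int \<Rightarrow> 'a \<Rightarrow> 'a"
  assumes \<zeta>: "twisting_system K A \<zeta>"
begin

lemma zeta_automorphism: "graded_linear_automorphism K A (\<zeta> n)"
  using \<zeta> by (simp add: twisting_system_def)

lemmas zeta_add = graded_linear_automorphismD(2)[OF zeta_automorphism]
lemmas zeta_scale = graded_linear_automorphismD(3)[OF zeta_automorphism]
lemmas zeta_grade = graded_linear_automorphismD(4)[OF zeta_automorphism]
lemmas zeta_closed = graded_linear_automorphism_closed[OF zeta_automorphism]

lemma inv_zeta_closed: "x \<in> carrier A \<Longrightarrow> inv_into (carrier A) (\<zeta> n) x \<in> carrier A"
  and inv_zeta_left: "x \<in> carrier A \<Longrightarrow> inv_into (carrier A) (\<zeta> n) (\<zeta> n x) = x"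
  and inv_zeta_right: "x \<in> carrier A \<Longrightarrow> \<zeta> n (inv_into (carrier A) (\<zeta> n) x) = x"
  and inv_zeta_grade: "x \<in> grade A i \<Longrightarrow> inv_into (carrier A) (\<zeta> n) x \<in> grade A i"
proof -
  note bij = graded_linear_automorphismD(1)[OF zeta_automorphism, of n]
  show "x \<in> carrier A \<Longrightarrow> inv_into (carrier A) (\<zeta> n) x \<in> carrier A"
    using bij_betw_apply[OF bij_betw_inv_into[OF bij]] .
  show "x \<in> carrier A \<Longrightarrow> inv_into (carrier A) (\<zeta> n) (\<zeta> n x) = x"
    using bij by (rule bij_betw_inv_into_left)
  show "x \<in> carrier A \<Longrightarrow> \<zeta> n (inv_into (carrier A) (\<zeta> n) x) = x"
    using bij by (rule bij_betw_inv_into_right)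
  show "x \<in> grade A i \<Longrightarrow> inv_into (carrier A) (\<zeta> n) x \<in> grade A i"
    by (rule inv_into_grade[OF bij zeta_add zeta_grade])
qed

text \<open>Both sides are additive in \<open>x\<close>, so the twisting law extends to all
  \<open>x\<close>; \<open>y\<close> stays homogeneous, since its degree enters the indices.\<close>

lemma zeta_mult:
  assumes x: "x \<in> carrier A" and y: "y \<in> grade A m"
  shows "\<zeta> n (\<zeta> m x \<otimes>\<^bsub>A\<^esub> y) = \<zeta> (n + m) x \<otimes>\<^bsub>A\<^esub> \<zeta> n y"
  using x
proof (induction x rule: homogeneous_induct)
  case (homogeneous i x)
  then show ?case
    using \<zeta> y by (simp add: twisting_system_def add.commute)
next
  case (add x x')
  then show ?case
    using grade_closed[OF y] by (simp add: zeta_add zeta_closed A.l_distr)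
qed

lemma zhang_mult_additive:
  "x \<in> carrier A \<Longrightarrow> homogeneous_additive A A (\<lambda>m y. \<zeta> m x \<otimes>\<^bsub>A\<^esub> y)"
  by unfold_locales (auto simp: zeta_closed grade_closed A.r_distr)

lemma zhang_mult_eq:
  "x \<otimes>\<^bsub>zhang_twist A \<zeta>\<^esub> y = additive_extension A A (\<lambda>m y. \<zeta> m x \<otimes>\<^bsub>A\<^esub> y) y"
  by (simp add: zhang_twist_def additive_extension_def)

lemma zhang_mult_closed:
  "\<lbrakk>x \<in> carrier A; y \<in> carrier A\<rbrakk> \<Longrightarrow> x \<otimes>\<^bsub>zhang_twist A \<zeta>\<^esub> y \<in> carrier A"
  by (simp add: zhang_mult_eq homogeneous_additive.extension_closed[OF zhang_mult_additive])

lemma zhang_r_distr: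
  "\<lbrakk>x \<in> carrier A; y \<in> carrier A; z \<in> carrier A\<rbrakk> \<Longrightarrow> x \<otimes>\<^bsub>zhang_twist A \<zeta>\<^esub> (y \<oplus>\<^bsub>A\<^esub> z)
    = x \<otimes>\<^bsub>zhang_twist A \<zeta>\<^esub> y \<oplus>\<^bsub>A\<^esub> x \<otimes>\<^bsub>zhang_twist A \<zeta>\<^esub> z"
  by (simp add: zhang_mult_eq homogeneous_additive.extension_add[OF zhang_mult_additive])

lemma zhang_l_distr:
  assumes "x \<in> carrier A" "y \<in> carrier A" "z \<in> carrier A"
  shows "(x \<oplus>\<^bsub>A\<^esub> y) \<otimes>\<^bsub>zhang_twist A \<zeta>\<^esub> z
    = x \<otimes>\<^bsub>zhang_twist A \<zeta>\<^esub> z \<oplus>\<^bsub>A\<^esub> y \<otimes>\<^bsub>zhang_twist A \<zeta>\<^esub> z"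
  using assms(3)
proof (induction z rule: homogeneous_induct)
  case (homogeneous i z)
  then show ?case
    using assms(1,2) grade_closed[OF homogeneous]
    by (simp add: zhang_twist_mult_homogeneous[OF \<zeta> _ homogeneous] zeta_add zeta_closed A.l_distr)
next
  case (add z w)
  then show ?case
    using assms(1,2) by (simp add: zhang_r_distr zhang_mult_closed a_ac)
qed

text \<open>The twisting law in terms of the new product: the \<open>\<theta>_mult\<close> of
  \<open>ring_twist\<close>, and the source of associativity and of the right identity.\<close>

lemma zeta_zhang_mult:
  assumes "x \<in> carrier A" "y \<in> grade A m"
  shows "\<zeta> n (x \<otimes>\<^bsub>zhang_twist A \<zeta>\<^esub> y) = \<zeta> (n + m) x \<otimes>\<^bsub>A\<^esub> \<zeta> n y"
  using assms by (simp add: zhang_twist_mult_homogeneous[OF \<zeta>] zeta_mult)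

text \<open>With \<open>y\<close> of degree \<open>m\<close> and \<open>z\<close> of degree
  \<open>n\<close>, both sides are \<open>\<zeta> (m + n) x \<cdot> \<zeta> n y \<cdot> z\<close> in
  \<open>A\<close>; on the right because \<open>y * z\<close> is
  \<open>\<zeta> n y \<cdot> z\<close>, of degree \<open>m + n\<close>.\<close>

lemma zhang_assoc:
  assumes x: "x \<in> carrier A" and y: "y \<in> carrier A" and z: "z \<in> carrier A"
  shows "(x \<otimes>\<^bsub>zhang_twist A \<zeta>\<^esub> y) \<otimes>\<^bsub>zhang_twist A \<zeta>\<^esub> z
    = x \<otimes>\<^bsub>zhang_twist A \<zeta>\<^esub> (y \<otimes>\<^bsub>zhang_twist A \<zeta>\<^esub> z)"
  using z
proof (induction z rule: homogeneous_induct)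
  case (homogeneous n z)
  note z = grade_closed[OF homogeneous]
  from y show ?case
  proof (induction y rule: homogeneous_induct)
    case (homogeneous m y)
    note hom = zhang_twist_mult_homogeneous[OF \<zeta>]
    have yz: "\<zeta> n y \<otimes>\<^bsub>A\<^esub> z \<in> grade A (m + n)"
      using grade_mult[OF zeta_grade[OF homogeneous] \<open>z \<in> grade A n\<close>] .
    show ?case
      using x z grade_closed[OF homogeneous]
      by (simp add: hom[OF _ \<open>z \<in> grade A n\<close>] zhang_mult_closed zeta_zhang_mult[OF _ homogeneous]
          hom[OF _ yz] zeta_closed A.m_assoc add.commute)
  next
    case (add y y')
    then show ?case
      using x z by (simp add: zhang_r_distr zhang_l_distr zhang_mult_closed)
  qed
next
  case (add z w)
  then show ?case
    using x y by (simp add: zhang_r_distr zhang_mult_closed)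
qed

lemma zhang_one: "\<one>\<^bsub>zhang_twist A \<zeta>\<^esub> = inv_into (carrier A) (\<zeta> 0) \<one>\<^bsub>A\<^esub>"
  by (simp add: zhang_twist_def)

lemma zhang_one_grade: "\<one>\<^bsub>zhang_twist A \<zeta>\<^esub> \<in> grade A 0"
  by (simp add: zhang_one inv_zeta_grade one_grade)

lemma zhang_one_closed: "\<one>\<^bsub>zhang_twist A \<zeta>\<^esub> \<in> carrier A"
  by (rule grade_closed[OF zhang_one_grade])

text \<open>For the new identity \<open>e\<close> and the \<open>y\<close> of degree 0 with
  \<open>\<zeta> n y = 1\<close>, the twisting law equates
  \<open>\<zeta> n (\<zeta> 0 e \<cdot> y)\<close>, which is 1 because
  \<open>\<zeta> 0 e = 1\<close>, with \<open>\<zeta> n e \<cdot> 1\<close>.\<close>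

lemma zeta_zhang_one: "\<zeta> n \<one>\<^bsub>zhang_twist A \<zeta>\<^esub> = \<one>\<^bsub>A\<^esub>"
proof -
  let ?e = "\<one>\<^bsub>zhang_twist A \<zeta>\<^esub>" and ?y = "inv_into (carrier A) (\<zeta> n) \<one>\<^bsub>A\<^esub>"
  have y: "?y \<in> grade A 0" "\<zeta> n ?y = \<one>\<^bsub>A\<^esub>"
    by (simp_all add: inv_zeta_grade one_grade inv_zeta_right)
  have "\<zeta> 0 ?e = \<one>\<^bsub>A\<^esub>"
    by (simp add: zhang_one inv_zeta_right)
  then have "\<zeta> n (\<one>\<^bsub>A\<^esub> \<otimes>\<^bsub>A\<^esub> ?y) = \<zeta> n ?e \<otimes>\<^bsub>A\<^esub> \<zeta> n ?y"
    using zeta_mult[OF zhang_one_closed y(1), of n] by simp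
  then show ?thesis
    using grade_closed[OF y(1)] by (simp add: y(2) zeta_closed zhang_one_closed)
qed

lemma zhang_l_one: "x \<in> carrier A \<Longrightarrow> \<one>\<^bsub>zhang_twist A \<zeta>\<^esub> \<otimes>\<^bsub>zhang_twist A \<zeta>\<^esub> x = x"
proof (induction x rule: homogeneous_induct)
  case (homogeneous i x)
  then show ?case
    using grade_closed[OF homogeneous]
    by (simp add: zhang_twist_mult_homogeneous[OF \<zeta> zhang_one_closed homogeneous] zeta_zhang_one)
next
  case (add x y)
  then show ?case
    by (simp add: zhang_r_distr zhang_one_closed)
qed

text \<open>Written out, the product is \<open>\<zeta> 0 x \<cdot> e\<close>, where the new identity
  \<open>e\<close> may differ from the old one. Comparing after the injective
  \<open>\<zeta> 0\<close> replaces \<open>e\<close> by 1.\<close>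

lemma zhang_r_one:
  assumes x: "x \<in> carrier A"
  shows "x \<otimes>\<^bsub>zhang_twist A \<zeta>\<^esub> \<one>\<^bsub>zhang_twist A \<zeta>\<^esub> = x"
proof -
  have "\<zeta> 0 (x \<otimes>\<^bsub>zhang_twist A \<zeta>\<^esub> \<one>\<^bsub>zhang_twist A \<zeta>\<^esub>) = \<zeta> 0 x"
    using x zeta_zhang_mult[OF x zhang_one_grade, of 0] by (simp add: zeta_zhang_one zeta_closed)
  then show ?thesis
    using x inv_zeta_left zhang_mult_closed zhang_one_closed by metis
qed

lemma ring_zhang_twist: "ring (zhang_twist A \<zeta>)"
proof (rule ringI)
  show "abelian_group (zhang_twist A \<zeta>)"
    by (rule abelian_group_cong[OF abelian_group_axioms]) simp_all
  show "monoid (zhang_twist A \<zeta>)"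
    by (rule monoidI)
      (simp_all add: zhang_mult_closed zhang_one_closed zhang_assoc zhang_l_one zhang_r_one)
qed (simp_all add: zhang_l_distr zhang_r_distr)

lemma ring_twist_zhang_twist:
  "ring_twist A (zhang_twist A \<zeta>) \<zeta> (\<lambda>n. inv_into (carrier A) (\<zeta> n))"
proof -
  interpret B: ring "zhang_twist A \<zeta>"
    by (rule ring_zhang_twist)
  show ?thesis
    by unfold_locales
      (simp_all add: zeta_add zeta_closed zeta_grade inv_zeta_closed inv_zeta_left inv_zeta_right
        inv_zeta_grade zeta_zhang_mult zeta_zhang_one)
qed

end

end

text \<open>A nonzero element lies in the group of units; there the laws for integer exponents hold,
  and powers have the same value.\<close>

lemma (in field) int_pow_nonzero:
  fixes m n :: int
  assumes "x \<in> carrier R - {\<zero>}"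
  shows "x [^] n \<in> carrier R" "x [^] (m + n) = x [^] m \<otimes> x [^] n"
proof -
  interpret U: group "units_of R"
    by (rule units_group)
  have x: "x \<in> Units R"
    using assms field_Units by simp
  have pow: "x [^]\<^bsub>units_of R\<^esub> k = x [^] k" for k :: int
    using x U.nat_pow_closed[of x "nat (- k)"]
    by (simp add: int_pow_def2 units_of_pow units_of_inv units_of_carrier del: pow_nat)
  have xU: "x \<in> carrier (units_of R)"
    using x by (simp add: units_of_carrier)
  show "x [^] n \<in> carrier R"
    using U.int_pow_closed[OF xU, of n] by (simp add: pow units_of_carrier Units_closed)
  show "x [^] (m + n) = x [^] m \<otimes> x [^] n"
    using U.int_pow_mult[OF xU, of m n] by (simp add: pow units_of_mult)
qed

theorem theorem3p5:
  fixes K :: "('k, 'r) ring_scheme"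
    and A :: "('k, 'a) graded_module"
    and f :: 'a and d :: nat and \<sigma> :: "'a \<Rightarrow> 'a"
    and \<zeta> :: "int \<Rightarrow> 'a \<Rightarrow> 'a" and c :: 'k
  assumes "connected_graded_algebra K A"
    and "f \<in> grade A (int d)"
    and "normal_element A f"
    and "regular_element A f"
    and "normalizing_automorphism K A f \<sigma>"
    and "twisting_system K A \<zeta>"
    and "\<forall>n. \<forall>a\<in>carrier A. \<zeta> n (\<sigma> (\<zeta> (int d) a)) = \<sigma> (\<zeta> (n + int d) a)"
    and "c \<in> carrier K - {\<zero>\<^bsub>K\<^esub>}"
    and "\<forall>n::int. \<zeta> n f = (c [^]\<^bsub>K\<^esub> n) \<odot>\<^bsub>A\<^esub> f"
  shows "equivalent_categories
    (TMF A f d \<sigma> ::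
      (('a, 'm) factorization, ('m \<Rightarrow> 'm) \<times> ('m \<Rightarrow> 'm)) category)
    (TMF (zhang_twist A \<zeta>) f d (twisted_automorphism K A d \<sigma> \<zeta> c) ::
      (('a, 'm) factorization, ('m \<Rightarrow> 'm) \<times> ('m \<Rightarrow> 'm)) category)"
proof -
  interpret connected_graded_algebra K A
    by fact
  note f = assms(2) and \<zeta> = assms(6) and c = assms(8)
  let ?B = "zhang_twist A \<zeta>" and ?\<sigma>' = "twisted_automorphism K A d \<sigma> \<zeta> c"
  interpret ring_twist A ?B \<zeta> "\<lambda>n. inv_into (carrier A) (\<zeta> n)"
    by (rule ring_twist_zhang_twist[OF \<zeta>])
  have \<sigma>: "graded_algebra_automorphism K A \<sigma>" "graded_linear_automorphism K A \<sigma>"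
    and \<sigma>_hom: "\<sigma> \<in> ring_hom A A"
    using assms(5)
    by (auto simp: normalizing_automorphism_def graded_algebra_automorphism_def ring_iso_def)
  note \<sigma>_closed = graded_linear_automorphism_closed[OF \<sigma>(2)]
    and \<sigma>_linear = graded_linear_automorphismD(2-4)[OF \<sigma>(2)]
  note pow = K.int_pow_nonzero[OF c]
  interpret \<sigma>': homogeneous_additive A A
    "\<lambda>i a. (c [^]\<^bsub>K\<^esub> (- i)) \<odot>\<^bsub>A\<^esub> \<sigma> (\<zeta> (int d) a)"
    by unfold_locales
      (simp_all add: grade_closed pow \<sigma>_closed \<sigma>_linear zeta_closed[OF \<zeta>] zeta_add[OF \<zeta>]
        smult_r_distr)
  have \<sigma>'_eq: "?\<sigma>' = additive_extension A A
      (\<lambda>i a. (c [^]\<^bsub>K\<^esub> (- i)) \<odot>\<^bsub>A\<^esub> \<sigma> (\<zeta> (int d) a))"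
    by (simp add: fun_eq_iff twisted_automorphism_def additive_extension_def)
  have \<sigma>'_hom: "?\<sigma>' x = (c [^]\<^bsub>K\<^esub> (- i)) \<odot>\<^bsub>A\<^esub> \<sigma> (\<zeta> (int d) x)" if "x \<in> grade A i" for x i
    using \<sigma>'.extension_homogeneous[OF that] by (simp add: \<sigma>'_eq)
  \<comment> \<open>Multiples of the identities turn scalars into ring elements. \<open>v\<close> is
    built on the identity of the twist, which every \<open>\<zeta> k\<close> sends to that of
    \<open>A\<close>; by linearity \<open>\<theta>_v\<close> then holds for all
    \<open>k\<close>.\<close>
  interpret factorization_twist A ?B \<zeta> "\<lambda>n. inv_into (carrier A) (\<zeta> n)" f d \<sigma> ?\<sigma>'
    "\<lambda>n. (c [^]\<^bsub>K\<^esub> n) \<odot>\<^bsub>A\<^esub> \<one>\<^bsub>A\<^esub>" "\<lambda>n. (c [^]\<^bsub>K\<^esub> (- n)) \<odot>\<^bsub>A\<^esub> \<one>\<^bsub>?B\<^esub>"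
  proof
    show "?\<sigma>' x \<in> grade A i" if "x \<in> grade A i" for x i
      using that by (simp add: \<sigma>'_hom[OF that] grade_smult pow \<sigma>_linear(3) zeta_grade[OF \<zeta>])
    show "?\<sigma>' x \<in> carrier A" if "x \<in> carrier A" for x
      using \<sigma>'.extension_closed[OF that] by (simp add: \<sigma>'_eq)
    show "?\<sigma>' (x \<oplus>\<^bsub>A\<^esub> y) = ?\<sigma>' x \<oplus>\<^bsub>A\<^esub> ?\<sigma>' y" if "x \<in> carrier A" "y \<in> carrier A" for x y
      using \<sigma>'.extension_add[OF that] by (simp add: \<sigma>'_eq)
    show "(c [^]\<^bsub>K\<^esub> - n) \<odot>\<^bsub>A\<^esub> \<one>\<^bsub>?B\<^esub> \<in> grade A 0" for n :: int
      by (rule grade_smult[OF pow(1) zhang_one_grade[OF \<zeta>]])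
    show "\<zeta> k ((c [^]\<^bsub>K\<^esub> - n) \<odot>\<^bsub>A\<^esub> \<one>\<^bsub>?B\<^esub>) = (c [^]\<^bsub>K\<^esub> - n) \<odot>\<^bsub>A\<^esub> \<one>\<^bsub>A\<^esub>" for k and n :: int
      by (simp add: zeta_scale[OF \<zeta>] pow zhang_one_closed[OF \<zeta>] zeta_zhang_one[OF \<zeta>])
    show "(c [^]\<^bsub>K\<^esub> (m + n)) \<odot>\<^bsub>A\<^esub> \<one>\<^bsub>A\<^esub>
        = ((c [^]\<^bsub>K\<^esub> m) \<odot>\<^bsub>A\<^esub> \<one>\<^bsub>A\<^esub>) \<otimes>\<^bsub>A\<^esub> ((c [^]\<^bsub>K\<^esub> n) \<odot>\<^bsub>A\<^esub> \<one>\<^bsub>A\<^esub>)" for m n :: int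
      by (simp add: pow smult_assoc1 smult_mult_left)
    show "\<sigma> ((c [^]\<^bsub>K\<^esub> n) \<odot>\<^bsub>A\<^esub> \<one>\<^bsub>A\<^esub>) = (c [^]\<^bsub>K\<^esub> n) \<odot>\<^bsub>A\<^esub> \<one>\<^bsub>A\<^esub>" for n :: int
      using ring_hom_one[OF \<sigma>_hom] by (simp add: \<sigma>_linear(2) pow)
    show "\<zeta> n f = ((c [^]\<^bsub>K\<^esub> n) \<odot>\<^bsub>A\<^esub> \<one>\<^bsub>A\<^esub>) \<otimes>\<^bsub>A\<^esub> f" for n
      using assms(9) grade_closed[OF f] by (simp add: smult_mult_left pow)
    \<comment> \<open>Linearity moves the scalar of \<open>?\<sigma>'\<close> past
      \<open>\<zeta> n\<close>; the assumed relation between \<zeta> and \<sigma> then absorbs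
      \<open>\<zeta> n\<close> into the index \<open>n + int d\<close>.\<close>
    show "\<zeta> n (?\<sigma>' x) = ((c [^]\<^bsub>K\<^esub> (- i)) \<odot>\<^bsub>A\<^esub> \<one>\<^bsub>A\<^esub>) \<otimes>\<^bsub>A\<^esub> \<sigma> (\<zeta> (n + int d) x)"
      if "x \<in> grade A i" for x n i
      using assms(7) grade_closed[OF that]
      by (simp add: \<sigma>'_hom[OF that] zeta_scale[OF \<zeta>] pow \<sigma>_closed zeta_closed[OF \<zeta>] smult_mult_left)
  qed (simp_all add: f \<sigma>_closed \<sigma>_linear grade_smult one_grade pow smult_mult_left smult_mult_right)
  show ?thesis
    by (rule equivalent_categories_twist)
qed

end
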